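(* Let $V$ be a finite dimensional real or complex vector space. Let $S$ be a subsemigroup of $GL(V)$ generated by a finite set of commuting elements. Suppose there is a (non-empty) open cone $C$ in $V$ and an orbit $\mathcal{O}=S\cdot v_0=\{sv_0 : s\in S\}$ of $S$, with $v_0\in V$, such that $\mathcal{O}\cap C$ is coarsely dense in $C$. Then: (1) The closure $\overline{S}$ of $S$ in $GL(V)$ is an open subgroup of the Zariski closure of $S$. In particular, $\overline{S}$ has a finite number of connected components. (2) The map $\overline{S}\to V$, $g\mapsto gv_0$, is an analytic diffeomorphism of $\overline{S}$ onto an open cone in $V$. In particular $\dim \overline{S}=\dim_{\mathbb{R}} V$. (3) The closure of the orbit $\mathcal{O}$ in $V$ is a cone in $V$ which contains $C$.
   Context: All topological notions (open, closure, connected components, etc.) refer to the Euclidean topology unless "Zariski" is explicitly mentioned. A cone in $V$ is a subset invariant under multiplication by all positive real numbers. A subset $Y$ of a metric space $(X,d)$ is coarsely dense in $X$ if there is $D>0$ such that the open balls of radius $D$ with centers at points of $Y$ cover $X$; here $C$ carries the metric induced from any norm on $V$ (the notion does not depend on the norm). The Zariski closure of $S$ is its Zariski closure in $GL(V)$ as a real algebraic group (if $V$ is complex, regard it as a real vector space); "open subgroup of the Zariski closure" means open for the Euclidean topology. *)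

theory Defs
  imports "HOL-Analysis.Analysis" "HOL-Algebra.Group"
begin

subsection \<open>Linear groups\<close>

text \<open>
  The underlying real vector space of \<open>V\<close> is a Euclidean space \<open>'a\<close>. If \<open>V\<close> is complex, its scalar
  multiplication is an additional operation on \<open>'a\<close> extending the real one. In both cases \<open>GL(V)\<close> is
  a set of real-linear endomorphisms, with the topology of the operator norm.
\<close>

definition complex_structure :: "(complex \<Rightarrow> 'a::real_vector \<Rightarrow> 'a) \<Rightarrow> bool"
  where "complex_structure cscale \<longleftrightarrow>
    vector_space cscale \<and> (\<forall>r x. cscale (complex_of_real r) x = r *\<^sub>R x)"

definition general_linear ::
    "('k::field \<Rightarrow> 'a::euclidean_space \<Rightarrow> 'a) \<Rightarrow> ('a \<Rightarrow>\<^sub>L 'a) set"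
  where "general_linear sc =
    {g. Vector_Spaces.linear sc sc (blinfun_apply g) \<and> bij (blinfun_apply g)}"

definition composition_monoid ::
    "('a::real_normed_vector \<Rightarrow>\<^sub>L 'a) set \<Rightarrow> ('a \<Rightarrow>\<^sub>L 'a) monoid"
  where "composition_monoid G = \<lparr>carrier = G, mult = (o\<^sub>L), one = id_blinfun\<rparr>"

text \<open>The identity belongs to the generated semigroup only if it is a product of generators.\<close>

inductive_set semigroup_generated ::
    "('a::real_normed_vector \<Rightarrow>\<^sub>L 'a) set \<Rightarrow> ('a \<Rightarrow>\<^sub>L 'a) set"
  for F
  where
    generator: "f \<in> F \<Longrightarrow> f \<in> semigroup_generated F"
  | product: "\<lbrakk>f \<in> semigroup_generated F; g \<in> semigroup_generated F\<rbrakk>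
      \<Longrightarrow> f o\<^sub>L g \<in> semigroup_generated F"

text \<open>
  Regular functions on \<open>GL(V)\<close> are polynomials divided by powers of the determinant, so the zero sets
  of real polynomials on \<open>End(V)\<close> already give all Zariski closed subsets of \<open>GL(V)\<close>. The Zariski
  closure of \<open>S\<close> in \<open>G\<close> is \<open>zariski_closed G hull S\<close>.
\<close>

definition zariski_closed ::
    "('a::real_normed_vector \<Rightarrow>\<^sub>L 'a) set \<Rightarrow> ('a \<Rightarrow>\<^sub>L 'a) set \<Rightarrow> bool"
  where "zariski_closed G T \<longleftrightarrow>
    (\<exists>P. (\<forall>p\<in>P. real_polynomial_function p) \<and> T = {g \<in> G. \<forall>p\<in>P. p g = 0})"


subsection \<open>Cones and coarse density\<close>

text \<open>Unlike for the library's \<open>cone\<close> and \<open>conic\<close>, the factor is positive, so \<open>0\<close> need not belong to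
  a nonempty cone.\<close>

definition positive_cone :: "'a::real_vector set \<Rightarrow> bool"
  where "positive_cone C \<longleftrightarrow> (\<forall>x\<in>C. \<forall>c>0. c *\<^sub>R x \<in> C)"

definition coarsely_dense_in :: "'a::metric_space set \<Rightarrow> 'a set \<Rightarrow> bool"
  where "coarsely_dense_in Y X \<longleftrightarrow> Y \<subseteq> X \<and> (\<exists>D>0. X \<subseteq> (\<Union>y\<in>Y. ball y D))"


subsection \<open>Real-analytic maps and submanifolds\<close>

text \<open>
  These notions are meant for finite-dimensional spaces. A power series is grouped into its
  homogeneous parts \<open>P k\<close>; the geometric bound on them is, in finite dimension, equivalent to absolute
  convergence near \<open>0\<close> of the multivariate power series in coordinates.
\<close>

definition homogeneous_polynomial ::
    "nat \<Rightarrow> ('a::real_normed_vector \<Rightarrow> 'b::real_normed_vector) \<Rightarrow> bool"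
  where "homogeneous_polynomial k p \<longleftrightarrow>
    polynomial_function p \<and> (\<forall>t x. p (t *\<^sub>R x) = t ^ k *\<^sub>R p x)"

definition real_analytic_at ::
    "('a::real_normed_vector \<Rightarrow> 'b::real_normed_vector) \<Rightarrow> 'a \<Rightarrow> bool"
  where "real_analytic_at f x \<longleftrightarrow>
    (\<exists>P r M. r > 0 \<and> (\<forall>k. homogeneous_polynomial k (P k)) \<and>
      (\<forall>k h. norm (P k h) \<le> M * (norm h / r) ^ k) \<and>
      (\<forall>h. norm h < r \<longrightarrow> (\<lambda>k. P k h) sums f (x + h)))"

text \<open>A map on a subset is analytic if it extends locally to analytic maps on open sets of the ambient
  space; on an embedded analytic submanifold this is analyticity in charts.\<close>

definition real_analytic_on ::
    "('a::real_normed_vector \<Rightarrow> 'b::real_normed_vector) \<Rightarrow> 'a set \<Rightarrow> bool"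
  where "real_analytic_on f M \<longleftrightarrow>
    (\<forall>p\<in>M. \<exists>N F. open N \<and> p \<in> N \<and> (\<forall>x\<in>N. real_analytic_at F x) \<and> (\<forall>x\<in>M \<inter> N. F x = f x))"

definition analytic_diffeo ::
    "'a::real_normed_vector set \<Rightarrow> 'b::real_normed_vector set \<Rightarrow> ('a \<Rightarrow> 'b) \<Rightarrow> bool"
  where "analytic_diffeo M N f \<longleftrightarrow>
    bij_betw f M N \<and> real_analytic_on f M \<and> real_analytic_on (inv_into M f) N"

text \<open>Embedded analytic submanifolds of dimension \<open>d\<close>, by analytic slice charts. The manifold
  structure of a closed subgroup of \<open>GL(V)\<close> is that of an embedded submanifold of \<open>End(V)\<close>.\<close>

definition analytic_submanifold :: "nat \<Rightarrow> 'a::real_normed_vector set \<Rightarrow> bool"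
  where "analytic_submanifold d M \<longleftrightarrow>
    (\<forall>p\<in>M. \<exists>N N' (\<Phi> :: 'a \<Rightarrow> 'a) E.
      open N \<and> p \<in> N \<and> open N' \<and> analytic_diffeo N N' \<Phi> \<and>
      subspace E \<and> dim E = d \<and> \<Phi> ` (M \<inter> N) = N' \<inter> E)"

end

theory Submission
  imports Defs
begin

text \<open>
  A set that is coarsely dense in an open cone spans \<open>V\<close>, so \<open>v\<^sub>0\<close> is a cyclic vector of the commutative
  algebra \<open>A\<close> spanned by \<open>S\<close>. Evaluation at \<open>v\<^sub>0\<close> is therefore a linear isomorphism \<open>A \<rightarrow> V\<close>
  (\<open>cyclic_vector_algebra\<close>). It turns \<open>V\<close> into a commutative algebra with unit \<open>v\<^sub>0\<close>, the orbit into a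
  multiplicative semigroup of units, and every claim into one about the closure of this semigroup in
  the units of \<open>V\<close>.

  The image of the exponential map of the algebra is an open subgroup of the units, and the square of
  each unit lies in it (\<open>square_of_unit\<close>), for a path avoiding finitely many singular elements leads
  from the square to a positive scalar. So the semigroup is a union of finitely many products
  \<open>r Exp (\<Sum> p\<^sub>f X\<^sub>f)\<close>, where \<open>p\<^sub>f\<close> ranges over the natural numbers and \<open>Exp X\<^sub>f\<close> is the square of the
  generator \<open>f\<close> (\<open>finite_representatives\<close>). Let \<open>Q\<close> be the additive monoid generated by the \<open>X\<^sub>f\<close> and by
  the kernel of \<open>Exp\<close>. The core of the proof is that \<open>Q\<close> is dense in \<open>V\<close>.

  A patch of the cone at distance \<open>e\<^sup>t\<close> from the origin is met by the semigroup up to a bounded error.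
  In logarithmic coordinates this is an error of order \<open>e\<^sup>-\<^sup>t\<close>: finitely many translates of \<open>Q - t v\<^sub>0\<close> come
  exponentially close to every point of a fixed ball (\<open>coarsely_dense_semigroup.closure_Q\<close>). On the other
  hand \<open>Q\<close> has few elements that can be used for this. A generator \<open>X\<^sub>f\<close> either has its negative in the
  closure of \<open>Q\<close> or is positive for a linear functional that is nonnegative on \<open>Q\<close>
  (\<open>separating_functional\<close>). In the second case its multiplicity is bounded linearly in \<open>t\<close>, so modulo the
  group generated by the kernel and the generators of the first kind only polynomially many classes
  occur. Among exponentially many points of a segment in an arbitrary direction \<open>v\<close>, two belong to the
  same class, and this yields arbitrarily short elements of that group that are almost parallel to
  \<open>v\<close>. Hence \<open>v\<close> is in the closure of \<open>Q\<close> (\<open>dense_if_exponentially_fine\<close>).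

  By the density of \<open>Q\<close>, the closure of the semigroup contains the image of \<open>Exp\<close>, and it is a union of
  finitely many cosets of it among the units. It is a group, since the inverse of \<open>s\<close> is \<open>s\<close> times the
  inverse of the exponential \<open>s\<^sup>2\<close>, and it is invariant under positive scalars, since these are
  exponentials. A polynomial that vanishes on \<open>S\<close> vanishes on a nonempty open subset of \<open>A\<close>, so the
  Zariski closure of \<open>S\<close> is the group of all invertible members of \<open>A\<close>, in which the closure of \<open>S\<close> is
  open. As an open subset of the linear space \<open>A\<close> it is a submanifold, and evaluation at \<open>v\<^sub>0\<close> and its
  inverse are restrictions of linear maps.
\<close>

section \<open>The exponential of an operator\<close>

text \<open>A copy of the operators that writes composition as multiplication. It is a Banach algebra in the
  sense of the type classes, so the exponential series applies to it.\<close>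

typedef (overloaded) ('a::euclidean_space) endomorphism = "UNIV :: ('a \<Rightarrow>\<^sub>L 'a) set"
  morphisms operator_of Endo ..

setup_lifting type_definition_endomorphism

instantiation endomorphism :: (euclidean_space) real_normed_algebra_1
begin

lift_definition zero_endomorphism :: "'a endomorphism" is "0" .
lift_definition one_endomorphism :: "'a endomorphism" is "id_blinfun" .
lift_definition plus_endomorphism :: "'a endomorphism \<Rightarrow> 'a endomorphism \<Rightarrow> 'a endomorphism" is "(+)" .
lift_definition minus_endomorphism :: "'a endomorphism \<Rightarrow> 'a endomorphism \<Rightarrow> 'a endomorphism" is "(-)" .
lift_definition uminus_endomorphism :: "'a endomorphism \<Rightarrow> 'a endomorphism" is "uminus" .
lift_definition times_endomorphism :: "'a endomorphism \<Rightarrow> 'a endomorphism \<Rightarrow> 'a endomorphism" is "(o\<^sub>L)" .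
lift_definition scaleR_endomorphism :: "real \<Rightarrow> 'a endomorphism \<Rightarrow> 'a endomorphism" is "(*\<^sub>R)" .
lift_definition norm_endomorphism :: "'a endomorphism \<Rightarrow> real" is "norm" .
definition dist_endomorphism :: "'a endomorphism \<Rightarrow> 'a endomorphism \<Rightarrow> real"
  where "dist_endomorphism x y = norm (x - y)"
definition sgn_endomorphism :: "'a endomorphism \<Rightarrow> 'a endomorphism"
  where "sgn_endomorphism x = scaleR (inverse (norm x)) x"
definition uniformity_endomorphism :: "('a endomorphism \<times> 'a endomorphism) filter"
  where "uniformity_endomorphism = (INF e\<in>{0 <..}. principal {(x, y). dist x y < e})"
definition open_endomorphism :: "'a endomorphism set \<Rightarrow> bool"
  where "open_endomorphism S = (\<forall>x\<in>S. \<forall>\<^sub>F (x', y) in uniformity. x' = x \<longrightarrow> y \<in> S)"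

instance
proof
  fix a b c :: "'a endomorphism" and r s :: real
  show "a * b * c = a * (b * c)" by transfer (rule blinfun_eqI, simp)
  show "(a + b) * c = a * c + b * c" by transfer (rule blinfun_eqI, simp add: blinfun.bilinear_simps)
  show "a * (b + c) = a * b + a * c" by transfer (rule blinfun_eqI, simp add: blinfun.bilinear_simps)
  show "r *\<^sub>R a * b = r *\<^sub>R (a * b)" by transfer (rule blinfun_eqI, simp add: blinfun.bilinear_simps)
  show "a * r *\<^sub>R b = r *\<^sub>R (a * b)" by transfer (rule blinfun_eqI, simp add: blinfun.bilinear_simps)
  show "1 * a = a" by transfer (rule blinfun_eqI, simp)
  show "a * 1 = a" by transfer (rule blinfun_eqI, simp)
  show "norm (1::'a endomorphism) = 1" by transfer simp
  moreover have "norm (0::'a endomorphism) = 0" by transfer simp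
  ultimately show "(0::'a endomorphism) \<noteq> 1" by (metis zero_neq_one)
  show "norm (a * b) \<le> norm a * norm b" by transfer (rule norm_blinfun_compose)
  show "norm (a + b) \<le> norm a + norm b" by transfer (rule norm_triangle_ineq)
  show "(norm a = 0) = (a = 0)" by transfer simp
  show "norm (r *\<^sub>R a) = \<bar>r\<bar> * norm a" by transfer simp
qed (rule dist_endomorphism_def sgn_endomorphism_def uniformity_endomorphism_def
      open_endomorphism_def | (transfer, simp add: algebra_simps))+

end

instance endomorphism :: (euclidean_space) banach
proof
  fix X :: "nat \<Rightarrow> 'a endomorphism" assume X: "Cauchy X"
  have dist_eq: "dist a b = dist (operator_of a) (operator_of b)" for a b :: "'a endomorphism"
    unfolding dist_norm by transfer simp
  have "Cauchy (\<lambda>n. operator_of (X n))"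
    using X unfolding Cauchy_def dist_eq .
  then obtain l where "(\<lambda>n. operator_of (X n)) \<longlonglongrightarrow> l"
    using convergent_eq_Cauchy by blast
  then have "X \<longlonglongrightarrow> Endo l"
    unfolding tendsto_iff dist_eq by (simp add: Endo_inverse)
  then show "convergent X" by (auto simp: convergent_def)
qed

definition operator_exp :: "('a::euclidean_space \<Rightarrow>\<^sub>L 'a) \<Rightarrow> ('a \<Rightarrow>\<^sub>L 'a)"
  where "operator_exp f = operator_of (exp (Endo f))"

lemma operator_exp_0: "operator_exp 0 = id_blinfun"
proof -
  have "Endo (0::'a \<Rightarrow>\<^sub>L 'a) = 0" by (simp add: zero_endomorphism_def)
  then show ?thesis by (simp add: operator_exp_def one_endomorphism.rep_eq)
qed

lemma operator_exp_scaleR_id: "operator_exp (t *\<^sub>R id_blinfun) = exp t *\<^sub>R id_blinfun"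
proof -
  have t: "Endo (t *\<^sub>R id_blinfun) = of_real t"
    unfolding of_real_def by transfer simp
  show ?thesis
    unfolding operator_exp_def t exp_of_real
    by (simp add: of_real_def scaleR_endomorphism.rep_eq one_endomorphism.rep_eq)
qed

lemma operator_exp_add:
  assumes "f o\<^sub>L g = g o\<^sub>L f"
  shows "operator_exp (f + g) = operator_exp f o\<^sub>L operator_exp g"
proof -
  have "Endo f * Endo g = Endo g * Endo f" using assms by transfer
  moreover have "Endo (f + g) = Endo f + Endo g" by transfer simp
  ultimately show ?thesis
    by (simp add: operator_exp_def exp_add_commuting times_endomorphism.rep_eq)
qed

text \<open>Multiplication by \<open>g\<close> passes through the exponential series term by term.\<close>

lemma operator_exp_commute:
  assumes "f o\<^sub>L g = g o\<^sub>L f"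
  shows "operator_exp f o\<^sub>L g = g o\<^sub>L operator_exp f"
proof -
  have c: "Endo f * Endo g = Endo g * Endo f" using assms by transfer
  have cn: "Endo f ^ n * Endo g = Endo g * Endo f ^ n" for n
    using c by (metis power_commuting_commutes)
  have "exp (Endo f) * Endo g = Endo g * exp (Endo f)"
    by (simp add: exp_def suminf_mult[symmetric] summable_exp_generic suminf_mult2 cn)
  then have "operator_of (exp (Endo f) * Endo g) = operator_of (Endo g * exp (Endo f))" by simp
  then show ?thesis
    by (simp add: operator_exp_def times_endomorphism.rep_eq Endo_inverse)
qed

text \<open>As \<open>(n + 2)! \<ge> 2\<^sup>n\<^sup>+\<^sup>1\<close>, the remainder of the series is dominated by a geometric series.\<close>

lemma operator_exp_first_order:
  assumes "norm f \<le> 1"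
  shows "norm (operator_exp f - id_blinfun - f) \<le> (norm f)\<^sup>2"
proof -
  let ?x = "Endo f"
  have nx: "norm ?x = norm f" by transfer simp
  let ?a = "\<lambda>n. inverse (fact (n + 2)) *\<^sub>R (?x ^ (n + 2))"
  let ?b = "\<lambda>n. (norm f)\<^sup>2 * (inverse 2 ^ (n + 1))"
  have le: "norm (?a n) \<le> ?b n" for n
  proof -
    have f2: "(2::real) ^ (n + 1) \<le> fact (n + 2)"
    proof (induction n)
      case (Suc n)
      have "(2::real) ^ (Suc n + 1) = 2 * 2 ^ (n + 1)" by simp
      also have "\<dots> \<le> (real n + 3) * fact (n + 2)"
        using Suc by (intro mult_mono) auto
      also have "\<dots> = fact (Suc n + 2)" by (simp add: algebra_simps)
      finally show ?case .
    qed simp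
    have "norm (?a n) = inverse (fact (n + 2)) * norm (?x ^ (n + 2))" by simp
    also have "\<dots> \<le> inverse (2 ^ (n + 1)) * norm f ^ (n + 2)"
      using f2 norm_power_ineq[of ?x "n + 2"]
      by (intro mult_mono) (auto simp: nx le_imp_inverse_le simp del: power_Suc fact_Suc add_2_eq_Suc')
    also have "norm f ^ (n + 2) \<le> (norm f)\<^sup>2"
      using assms by (intro power_decreasing) auto
    finally show ?thesis by (simp add: power_one_over field_simps del: power_Suc fact_Suc add_2_eq_Suc')
  qed
  have sb: "?b sums (norm f)\<^sup>2"
  proof -
    have "(\<lambda>n. inverse 2 ^ (n + 1)) sums (1::real)"
      using geometric_sums[of "inverse (2::real)"] sums_mult[of _ _ "inverse (2::real)"] by fastforce
    from sums_mult[OF this, of "(norm f)\<^sup>2"] show ?thesis by simp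
  qed
  have "exp ?x - 1 - ?x = (\<Sum>n. ?a n)" using exp_first_two_terms[of ?x] by (simp add: algebra_simps)
  then have "norm (exp ?x - 1 - ?x) \<le> (norm f)\<^sup>2"
    using norm_suminf_le[OF le sums_summable[OF sb]] sums_unique[OF sb] by simp
  moreover have "norm (exp ?x - 1 - ?x) = norm (operator_exp f - id_blinfun - f)"
    by (simp add: operator_exp_def norm_endomorphism.rep_eq minus_endomorphism.rep_eq one_endomorphism.rep_eq Endo_inverse)
  ultimately show ?thesis by simp
qed

section \<open>Finitely generated monoids with periods\<close>

lemma closure_add_mem:
  fixes Q :: "'a::real_normed_vector set"
  assumes "\<And>x y. x \<in> Q \<Longrightarrow> y \<in> Q \<Longrightarrow> x + y \<in> Q" "x \<in> closure Q" "y \<in> closure Q"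
  shows "x + y \<in> closure Q"
proof -
  obtain f where f: "\<And>n. f n \<in> Q" "f \<longlonglongrightarrow> x" using assms(2) by (auto simp: closure_sequential)
  obtain g where g: "\<And>n. g n \<in> Q" "g \<longlonglongrightarrow> y" using assms(3) by (auto simp: closure_sequential)
  have "(\<lambda>n. f n + g n) \<longlonglongrightarrow> x + y" using f g by (intro tendsto_add)
  moreover have "\<forall>n. f n + g n \<in> Q" using f g assms(1) by blast
  ultimately show ?thesis
    unfolding closure_sequential by (intro exI[of _ "\<lambda>n. f n + g n"] conjI)
qed

text \<open>The vectors \<open>X f\<close> will be logarithms of squares of the generators of a semigroup of units, and
  the periods \<open>\<Lambda>\<close> the kernel of the exponential map.\<close>

locale periodic_monoid =
  fixes F :: "'i set" and X :: "'i \<Rightarrow> 'a::euclidean_space" and \<Lambda> :: "'a set"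
  assumes finite_F: "finite F"
    and period_0: "0 \<in> \<Lambda>"
    and period_add: "x \<in> \<Lambda> \<Longrightarrow> y \<in> \<Lambda> \<Longrightarrow> x + y \<in> \<Lambda>"
    and period_minus: "x \<in> \<Lambda> \<Longrightarrow> - x \<in> \<Lambda>"
begin

definition combination :: "('i \<Rightarrow> nat) \<Rightarrow> 'a"
  where "combination p = (\<Sum>f\<in>F. real (p f) *\<^sub>R X f)"

definition Q :: "'a set"
  where "Q = {combination p + l | p l. l \<in> \<Lambda>}"

lemma QI: "l \<in> \<Lambda> \<Longrightarrow> combination p + l \<in> Q"
  by (auto simp: Q_def)

lemma combination_add: "combination (\<lambda>f. p f + q f) = combination p + combination q"
  by (simp add: combination_def scaleR_left_distrib sum.distrib)

lemma Q_add: "x \<in> Q \<Longrightarrow> y \<in> Q \<Longrightarrow> x + y \<in> Q"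
proof -
  assume "x \<in> Q" "y \<in> Q"
  then obtain p l q k where pq: "x = combination p + l" "l \<in> \<Lambda>" "y = combination q + k" "k \<in> \<Lambda>"
    by (auto simp: Q_def)
  then have "x + y = combination (\<lambda>f. p f + q f) + (l + k)" by (simp add: combination_add)
  then show "x + y \<in> Q" using pq period_add QI by metis
qed

lemma period_in_Q: "l \<in> \<Lambda> \<Longrightarrow> l \<in> Q"
  using QI[of l "\<lambda>_. 0"] by (simp add: combination_def)

lemma generator_in_Q: "f \<in> F \<Longrightarrow> X f \<in> Q"
  using QI[OF period_0, of "\<lambda>g. if g = f then 1 else 0"] finite_F
  by (simp add: combination_def if_distrib[of real] if_distrib[of "\<lambda>x. x *\<^sub>R _"] sum.delta cong: if_cong)

lemmas closure_Q_add = closure_add_mem[OF Q_add]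

lemma zero_in_closure_Q: "0 \<in> closure Q"
  using period_in_Q[OF period_0] closure_subset by blast

lemma closure_Q_nat_multiple: "x \<in> closure Q \<Longrightarrow> real n *\<^sub>R x \<in> closure Q"
  by (induction n) (auto simp: zero_in_closure_Q scaleR_left_distrib closure_Q_add)

lemma closure_Q_sum:
  assumes "\<And>f. f \<in> A \<Longrightarrow> x f \<in> closure Q"
  shows "(\<Sum>f\<in>A. x f) \<in> closure Q"
  using assms by (induction A rule: infinite_finite_induct) (auto simp: zero_in_closure_Q closure_Q_add)

lemma period_int_multiple: "l \<in> \<Lambda> \<Longrightarrow> of_int z *\<^sub>R l \<in> \<Lambda>"
proof -
  assume l: "l \<in> \<Lambda>"
  have n: "real n *\<^sub>R l \<in> \<Lambda>" for n
    by (induction n) (auto simp: period_0 scaleR_left_distrib l period_add)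
  show ?thesis
  proof (cases "z \<ge> 0")
    case True then show ?thesis using n[of "nat z"] by simp
  next
    case False then show ?thesis using period_minus[OF n[of "nat (- z)"]] by simp
  qed
qed

lemma period_sum: "(\<And>a. a \<in> T \<Longrightarrow> x a \<in> \<Lambda>) \<Longrightarrow> sum x T \<in> \<Lambda>"
  by (induction T rule: infinite_finite_induct) (auto simp: period_0 period_add)

text \<open>Write \<open>w\<close> as a combination of finitely many periods and round the coefficients of its multiples
  down.\<close>

lemma span_periods_cobounded:
  assumes "w \<in> span \<Lambda>"
  obtains R where "\<And>N::nat. \<exists>l\<in>\<Lambda>. norm (real N *\<^sub>R w - l) \<le> R"
proof -
  obtain T u where T: "finite T" "T \<subseteq> \<Lambda>" "w = (\<Sum>a\<in>T. u a *\<^sub>R a)"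
    using assms by (auto simp: span_explicit)
  have "\<exists>l\<in>\<Lambda>. norm (real N *\<^sub>R w - l) \<le> (\<Sum>a\<in>T. norm a)" for N
  proof
    let ?l = "\<Sum>a\<in>T. of_int \<lfloor>real N * u a\<rfloor> *\<^sub>R a"
    show "?l \<in> \<Lambda>" using T by (intro period_sum period_int_multiple) auto
    have "real N *\<^sub>R w - ?l = (\<Sum>a\<in>T. frac (real N * u a) *\<^sub>R a)"
      by (simp add: T scaleR_sum_right frac_def scaleR_left_diff_distrib sum_subtractf)
    also have "norm \<dots> \<le> (\<Sum>a\<in>T. norm a)"
    proof (rule sum_norm_le)
      fix a assume "a \<in> T"
      have "\<bar>frac (real N * u a)\<bar> \<le> 1" using frac_lt_1[of "real N * u a"] by (simp add: frac_ge_0 less_imp_le)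
      then show "norm (frac (real N * u a) *\<^sub>R a) \<le> norm a"
        using mult_right_mono[of _ 1 "norm a"] by auto
    qed
    finally show "norm (real N *\<^sub>R w - ?l) \<le> (\<Sum>a\<in>T. norm a)" .
  qed
  then show thesis using that by blast
qed

text \<open>If a relation \<open>X i + \<Sum> c f X f + w = 0\<close> with nonnegative real coefficients and \<open>w\<close> in the span of
  the periods is multiplied by \<open>N\<close> and its coefficients are rounded down, the results stay bounded, so
  two of them, say for \<open>M < N\<close>, are close to each other. As the rounded coefficients are monotone in
  the factor, the difference is a member of \<open>Q\<close> that contains \<open>X i\<close> at least once.\<close>

lemma minus_generator_in_closure:
  assumes i: "i \<in> F" and c: "\<And>f. f \<in> F \<Longrightarrow> c f \<ge> 0" and w: "w \<in> span \<Lambda>"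
    and eq: "- X i = (\<Sum>f\<in>F. c f *\<^sub>R X f) + w"
  shows "- X i \<in> closure Q"
proof -
  obtain R where "\<And>N::nat. \<exists>l\<in>\<Lambda>. norm (real N *\<^sub>R w - l) \<le> R"
    using span_periods_cobounded[OF w] by blast
  then obtain l where l: "\<And>N. l N \<in> \<Lambda>" "\<And>N::nat. norm (real N *\<^sub>R w - l N) \<le> R" by metis
  define y where "y N = real N *\<^sub>R X i + (\<Sum>f\<in>F. of_int \<lfloor>real N * c f\<rfloor> *\<^sub>R X f) + l N" for N
  have bd: "norm (y N) \<le> (\<Sum>f\<in>F. norm (X f)) + R" for N
  proof -
    have Xi: "X i = - ((\<Sum>f\<in>F. c f *\<^sub>R X f) + w)" using eq by (metis minus_minus)
    have "y N = - (\<Sum>f\<in>F. frac (real N * c f) *\<^sub>R X f) - (real N *\<^sub>R w - l N)"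
      unfolding y_def Xi
      by (simp add: frac_def scaleR_left_diff_distrib sum_subtractf scaleR_sum_right algebra_simps)
    also have "norm \<dots> \<le> norm (\<Sum>f\<in>F. frac (real N * c f) *\<^sub>R X f) + norm (real N *\<^sub>R w - l N)"
      by (metis norm_minus_cancel norm_triangle_ineq4)
    also have "norm (\<Sum>f\<in>F. frac (real N * c f) *\<^sub>R X f) \<le> (\<Sum>f\<in>F. norm (X f))"
    proof (rule sum_norm_le)
      fix a assume "a \<in> F"
      have "\<bar>frac (real N * c a)\<bar> \<le> 1" using frac_lt_1[of "real N * c a"] by (simp add: frac_ge_0 less_imp_le)
      then show "norm (frac (real N * c a) *\<^sub>R X a) \<le> norm (X a)"
        using mult_right_mono[of _ 1 "norm (X a)"] by auto
    qed
    finally show ?thesis using l(2)[of N] by simp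
  qed
  have "bounded (range y)" using bd by (auto simp: bounded_iff)
  then obtain L r where r: "strict_mono r" "(y \<circ> r) \<longlonglongrightarrow> L"
    using bounded_imp_convergent_subsequence by blast
  show ?thesis
    unfolding closure_approachable
  proof (intro allI impI)
    fix e :: real assume "e > 0"
    then obtain n0 where n0: "\<And>m n. m \<ge> n0 \<Longrightarrow> n \<ge> n0 \<Longrightarrow> dist (y (r m)) (y (r n)) < e"
      using LIMSEQ_imp_Cauchy[OF r(2)] unfolding Cauchy_def comp_def by blast
    define M N where "M = r n0" "N = r (Suc n0)"
    have MN: "M < N" using r(1) by (simp add: M_N_def strict_mono_def)
    have d: "dist (y N) (y M) < e" using n0 by (simp add: M_N_def)
    define p where "p f = nat (\<lfloor>real N * c f\<rfloor> - \<lfloor>real M * c f\<rfloor>) + (if f = i then N - M - 1 else 0)" for f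
    have rp: "real (p f) = of_int \<lfloor>real N * c f\<rfloor> - of_int \<lfloor>real M * c f\<rfloor> + (if f = i then real N - real M - 1 else 0)"
      if "f \<in> F" for f
    proof -
      have "\<lfloor>real M * c f\<rfloor> \<le> \<lfloor>real N * c f\<rfloor>" using c[OF that] MN by (intro floor_mono mult_right_mono) auto
      then show ?thesis using MN by (simp add: p_def of_nat_diff)
    qed
    have "combination p = (\<Sum>f\<in>F. (of_int \<lfloor>real N * c f\<rfloor> - of_int \<lfloor>real M * c f\<rfloor>) *\<^sub>R X f + (if f = i then (real N - real M - 1) *\<^sub>R X i else 0))"
      unfolding combination_def by (intro sum.cong) (auto simp: rp scaleR_left_distrib simp flip: of_int_diff)
    also have "\<dots> = (\<Sum>f\<in>F. (of_int \<lfloor>real N * c f\<rfloor> - of_int \<lfloor>real M * c f\<rfloor>) *\<^sub>R X f) + (real N - real M - 1) *\<^sub>R X i"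
      using i finite_F by (simp add: sum.distrib sum.delta)
    finally have "combination p + (l N - l M) = y N - y M - X i"
      by (simp add: y_def algebra_simps sum_subtractf)
    moreover have "l N - l M \<in> \<Lambda>" using period_add[OF l(1) period_minus[OF l(1)]] by simp
    ultimately have "y N - y M - X i \<in> Q" using QI by metis
    moreover have "dist (y N - y M - X i) (- X i) < e" using d by (simp add: dist_norm)
    ultimately show "\<exists>z\<in>Q. dist z (- X i) < e" by blast
  qed
qed

text \<open>The convex cone generated by the \<open>X f\<close> and the span of the periods is finitely generated, hence
  closed. If it contains \<open>- X f\<close>, the preceding lemma applies. Otherwise a hyperplane separates \<open>- X f\<close>
  from the cone, and its normal vector is nonnegative on the cone and positive on \<open>X f\<close>. The sum of
  these normal vectors works for all generators at once.\<close>

lemma separating_functional: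
  obtains a where "\<And>f. f \<in> F \<Longrightarrow> a \<bullet> X f \<ge> 0" "\<And>l. l \<in> \<Lambda> \<Longrightarrow> a \<bullet> l = 0"
    "\<And>f. f \<in> F \<Longrightarrow> - X f \<in> closure Q \<or> a \<bullet> X f > 0"
proof -
  obtain B where B: "B \<subseteq> \<Lambda>" "independent B" "\<Lambda> \<subseteq> span B"
    using maximal_independent_subset by blast
  have finB: "finite B" using B(2) independent_imp_finite by blast
  define H where "H = convex_cone hull (X ` F \<union> B \<union> uminus ` B)"
  have clH: "closed H" unfolding H_def using finite_F finB by (intro closed_convex_cone_hull) auto
  have cvH: "convex H" unfolding H_def by (rule convex_convex_cone_hull)
  have H0: "0 \<in> H" unfolding H_def by (rule convex_cone_hull_contains_0)
  have Hadd: "x + y \<in> H" if "x \<in> H" "y \<in> H" for x y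
    using that unfolding H_def by (rule convex_cone_hull_add)
  have Hmul: "c *\<^sub>R x \<in> H" if "x \<in> H" "c \<ge> 0" for x c
    using that unfolding H_def by (rule convex_cone_hull_mul)
  have XH: "X f \<in> H" if "f \<in> F" for f
    unfolding H_def using that by (intro hull_inc) auto
  have BH: "b \<in> H \<and> - b \<in> H" if "b \<in> B" for b
    unfolding H_def using that by (auto intro!: hull_inc)
  have LH: "l \<in> H \<and> - l \<in> H" if "l \<in> \<Lambda>" for l
  proof -
    have "subspace {x. x \<in> H \<and> - x \<in> H}"
    proof (intro subspaceI CollectI)
      show "x + y \<in> H \<and> - (x + y) \<in> H" if "x \<in> {x. x \<in> H \<and> - x \<in> H}" "y \<in> {x. x \<in> H \<and> - x \<in> H}" for x y
        using that Hadd[of x y] Hadd[of "- x" "- y"] by simp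
      show "c *\<^sub>R x \<in> H \<and> - (c *\<^sub>R x) \<in> H" if "x \<in> {x. x \<in> H \<and> - x \<in> H}" for c x
        using that Hmul[of x "\<bar>c\<bar>"] Hmul[of "- x" "\<bar>c\<bar>"] by (cases "c \<ge> 0") auto
    qed (use H0 in auto)
    then have "span B \<subseteq> {x. x \<in> H \<and> - x \<in> H}" using BH by (intro span_minimal) auto
    then show ?thesis using B(3) that by blast
  qed
  have neg: "- X i \<in> closure Q" if i: "i \<in> F" "- X i \<in> H" for i
  proof -
    define K where "K = {(\<Sum>f\<in>F. c f *\<^sub>R X f) + w | c w. (\<forall>f\<in>F. c f \<ge> 0) \<and> w \<in> span \<Lambda>}"
    have KI: "(\<Sum>f\<in>F. c f *\<^sub>R X f) + w \<in> K" if "\<And>f. f \<in> F \<Longrightarrow> c f \<ge> 0" "w \<in> span \<Lambda>" for c w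
      using that unfolding K_def by blast
    have "H \<subseteq> K"
      unfolding H_def
    proof (rule hull_minimal)
      have "X f \<in> K" if "f \<in> F" for f
      proof -
        have "X f = (\<Sum>g\<in>F. (if g = f then 1 else 0) *\<^sub>R X g) + 0"
          using that finite_F by (simp add: if_distrib[of "\<lambda>x. x *\<^sub>R _"] sum.delta cong: if_cong)
        also have "\<dots> \<in> K" by (rule KI) (auto simp: span_zero)
        finally show ?thesis .
      qed
      moreover have "w \<in> K" if "w \<in> span \<Lambda>" for w
        using KI[of "\<lambda>_. 0" w] that by simp
      ultimately show "X ` F \<union> B \<union> uminus ` B \<subseteq> K"
        using B(1) span_base[of _ \<Lambda>] span_neg[of _ \<Lambda>] by blast
      show "convex_cone K"
        unfolding convex_cone_iff
      proof (intro conjI ballI allI impI)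
        show "0 \<in> K" using KI[of "\<lambda>_. 0" 0] by (simp add: span_zero)
        fix x y assume "x \<in> K" "y \<in> K"
        then obtain c w d z where 1: "x = (\<Sum>f\<in>F. c f *\<^sub>R X f) + w" "\<forall>f\<in>F. c f \<ge> 0" "w \<in> span \<Lambda>"
          "y = (\<Sum>f\<in>F. d f *\<^sub>R X f) + z" "\<forall>f\<in>F. d f \<ge> 0" "z \<in> span \<Lambda>" unfolding K_def by blast
        have "x + y = (\<Sum>f\<in>F. (c f + d f) *\<^sub>R X f) + (w + z)"
          by (simp add: 1 scaleR_left_distrib sum.distrib)
        also have "\<dots> \<in> K" using 1 by (intro KI) (auto simp: span_add)
        finally show "x + y \<in> K" .
      next
        fix x and s :: real assume "x \<in> K" "s \<ge> 0"
        then obtain c w where 1: "x = (\<Sum>f\<in>F. c f *\<^sub>R X f) + w" "\<forall>f\<in>F. c f \<ge> 0" "w \<in> span \<Lambda>"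
          unfolding K_def by blast
        have "s *\<^sub>R x = (\<Sum>f\<in>F. (s * c f) *\<^sub>R X f) + s *\<^sub>R w"
          by (simp add: 1 scaleR_right_distrib scaleR_sum_right)
        also have "\<dots> \<in> K" using 1 \<open>s \<ge> 0\<close> by (intro KI) (auto simp: span_scale)
        finally show "s *\<^sub>R x \<in> K" .
      qed
    qed
    then obtain c w where "- X i = (\<Sum>f\<in>F. c f *\<^sub>R X f) + w" "\<forall>f\<in>F. c f \<ge> 0" "w \<in> span \<Lambda>"
      using i(2) unfolding K_def by blast
    then show ?thesis using minus_generator_in_closure[OF i(1)] by blast
  qed
  have "\<exists>a. (\<forall>x\<in>H. a \<bullet> x \<ge> 0) \<and> (- X f \<in> H \<or> a \<bullet> X f > 0)" for f
  proof (cases "- X f \<in> H")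
    case True
    then show ?thesis by (intro exI[of _ 0]) auto
  next
    case False
    then obtain a b where ab: "a \<bullet> (- X f) < b" "\<And>x. x \<in> H \<Longrightarrow> a \<bullet> x > b"
      using separating_hyperplane_closed_point[OF cvH clH] by blast
    have b: "b < 0" using ab(2)[OF H0] by simp
    have "a \<bullet> x \<ge> 0" if x: "x \<in> H" for x
    proof (rule ccontr)
      assume n: "\<not> a \<bullet> x \<ge> 0"
      then have "(b / (a \<bullet> x)) *\<^sub>R x \<in> H" using b x by (intro Hmul) (auto simp: divide_nonpos_neg)
      from ab(2)[OF this] show False using n by simp
    qed
    then show ?thesis using ab(1) b by (intro exI[of _ a]) auto
  qed
  then obtain a where a: "\<And>f x. x \<in> H \<Longrightarrow> a f \<bullet> x \<ge> 0" "\<And>f. - X f \<in> H \<or> a f \<bullet> X f > 0" by metis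
  define A where "A = (\<Sum>f\<in>F. a f)"
  have A: "A \<bullet> x \<ge> 0" if "x \<in> H" for x
    unfolding A_def inner_sum_left using that a(1) by (intro sum_nonneg) auto
  show thesis
  proof (rule that)
    show "A \<bullet> X f \<ge> 0" if "f \<in> F" for f using A XH that by blast
    show "A \<bullet> l = 0" if "l \<in> \<Lambda>" for l
      using A[of l] A[of "- l"] LH[OF that] by simp
    show "- X f \<in> closure Q \<or> A \<bullet> X f > 0" if f: "f \<in> F" for f
    proof (cases "- X f \<in> H")
      case False
      then have "A \<bullet> X f > 0"
        unfolding A_def inner_sum_left using f finite_F a XH[OF f]
        by (intro sum_pos2[of _ f]) auto
      then show ?thesis by simp
    qed (use neg f in blast)
  qed
qed

text \<open>The functional \<open>a\<close> of the preceding lemma bounds, linearly in \<open>t\<close>, the multiplicities of the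
  generators on which it is positive. So polynomially many cosets of the group generated by the
  periods and the remaining generators suffice to approximate all points of the ball. Among
  exponentially many equally spaced points on a segment of direction \<open>v\<close>, two are then approximated in
  the same coset. The difference of their approximations is a short element of the group that is
  almost parallel to \<open>v\<close>, and a multiple of it approximates \<open>v\<close>.\<close>

lemma dense_if_exponentially_fine:
  assumes Y: "finite Y" and B: "open B" "B \<noteq> {}"
    and fine: "\<And>t b. t \<ge> t0 \<Longrightarrow> b \<in> B \<Longrightarrow> \<exists>y\<in>Y. \<exists>q\<in>Q. norm (b - (y + q - t *\<^sub>R u)) \<le> c * exp (- t)"
  shows "closure Q = UNIV"
proof -
  obtain a where a: "\<And>f. f \<in> F \<Longrightarrow> a \<bullet> X f \<ge> 0" "\<And>l. l \<in> \<Lambda> \<Longrightarrow> a \<bullet> l = 0"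
    "\<And>f. f \<in> F \<Longrightarrow> - X f \<in> closure Q \<or> a \<bullet> X f > 0"
    using separating_functional by blast
  define J where "J = {f\<in>F. a \<bullet> X f > 0}"
  have finJ: "finite J" using finite_F by (simp add: J_def)
  have group: "(\<Sum>f\<in>F. of_int (z f) *\<^sub>R X f) + l \<in> closure Q"
    if z: "\<And>f. f \<in> J \<Longrightarrow> z f = 0" and l: "l \<in> \<Lambda>" for z l
  proof (intro closure_Q_add closure_Q_sum)
    show "l \<in> closure Q" using period_in_Q[OF l] closure_subset by blast
    fix f assume f: "f \<in> F"
    consider "f \<in> J" | "- X f \<in> closure Q" using f a(3) by (auto simp: J_def)
    then show "of_int (z f) *\<^sub>R X f \<in> closure Q"
    proof cases
      case 1
      then show ?thesis using z zero_in_closure_Q by simp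
    next
      case 2
      show ?thesis
      proof (cases "z f \<ge> 0")
        case True
        then show ?thesis
          using closure_Q_nat_multiple[of "X f" "nat (z f)"] generator_in_Q[OF f] closure_subset by auto
      next
        case False
        then show ?thesis using closure_Q_nat_multiple[OF 2, of "nat (- z f)"] by simp
      qed
    qed
  qed
  obtain \<mu> where \<mu>: "\<mu> > 0" "\<And>f. f \<in> J \<Longrightarrow> a \<bullet> X f \<ge> \<mu>"
  proof
    let ?m = "Min (insert 1 ((\<lambda>f. a \<bullet> X f) ` J))"
    show "?m > 0" using finJ by (subst Min_gr_iff) (auto simp: J_def)
    show "a \<bullet> X f \<ge> ?m" if "f \<in> J" for f using finJ that by (intro Min_le) auto
  qed
  obtain b0 r0 where b0: "r0 > 0" "ball b0 r0 \<subseteq> B" using B openE by blast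
  obtain My where My: "My \<ge> 0" "\<And>y. y \<in> Y \<Longrightarrow> norm y \<le> My"
    using finite_imp_bounded[OF Y] unfolding bounded_iff by (metis abs_ge_self abs_ge_zero order_trans)
  define C1 where "C1 = norm a * (norm b0 + r0 + My + \<bar>c\<bar>) / \<mu>"
  define C2 where "C2 = norm a * norm u / \<mu>"
  have C: "C1 \<ge> 0" "C2 \<ge> 0" using \<mu>(1) My(1) b0(1) by (simp_all add: C1_def C2_def)
  have bound: "real (p f) \<le> C1 + C2 * t"
    if "f \<in> J" "t \<ge> 0" "norm (b - b0) < r0" "y \<in> Y" "l \<in> \<Lambda>"
      "norm (b - (y + (combination p + l) - t *\<^sub>R u)) \<le> c * exp (- t)" for p f t b y l
  proof -
    let ?q = "combination p + l"
    let ?d = "b - (y + ?q - t *\<^sub>R u)"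
    have "c * exp (- t) \<le> \<bar>c\<bar> * 1" using that(2) by (intro mult_mono) auto
    then have d: "norm ?d \<le> \<bar>c\<bar>" using that(6) by linarith
    have q: "?q = b - y + t *\<^sub>R u - ?d" by simp
    have "norm ?q \<le> norm b + norm y + norm (t *\<^sub>R u) + norm ?d"
      by (subst q) (smt (verit) norm_triangle_ineq norm_triangle_ineq4)
    also have "\<dots> \<le> norm b0 + r0 + My + \<bar>c\<bar> + norm u * t"
      using d My(2)[OF that(4)] that(2,3) norm_triangle_ineq2[of b b0] by simp
    finally have nq: "norm ?q \<le> norm b0 + r0 + My + \<bar>c\<bar> + norm u * t" .
    have "real (p f) * \<mu> \<le> real (p f) * (a \<bullet> X f)" using \<mu>(2)[OF that(1)] by (intro mult_left_mono) auto
    also have "\<dots> \<le> (\<Sum>f\<in>F. real (p f) * (a \<bullet> X f))"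
      using that(1) finite_F a(1) by (intro member_le_sum) (auto simp: J_def)
    also have "\<dots> = a \<bullet> ?q" using a(2)[OF that(5)]
      by (simp add: combination_def inner_add_right inner_sum_right)
    also have "\<dots> \<le> norm a * norm ?q" by (rule norm_cauchy_schwarz)
    also have "\<dots> \<le> norm a * (norm b0 + r0 + My + \<bar>c\<bar> + norm u * t)"
      using nq by (intro mult_left_mono) auto
    also have "\<dots> = (C1 + C2 * t) * \<mu>" using \<mu>(1) by (simp add: C1_def C2_def field_simps)
    finally show ?thesis using \<mu>(1) by simp
  qed
  have "v \<in> closure Q" for v
  proof (cases "v = 0")
    case True
    then show ?thesis using zero_in_closure_Q by simp
  next
    case False
    show ?thesis
      unfolding closure_approachable
      \<comment> \<open>The other half of \<open>e'\<close> is for passing from the closure of \<open>Q\<close> to \<open>Q\<close>.\<close>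
    proof (intro allI impI)
      fix e' :: real assume "e' > 0"
      define e where "e = e' / 2"
      have e: "e > 0" using \<open>e' > 0\<close> by (simp add: e_def)
      define n where "n = card J"
      \<comment> \<open>With \<open>t = 2 s\<close>, the points on the segment have the distance \<open>e\<^sup>-\<^sup>s norm v\<close>, which is large
        compared to the error \<open>c e\<^sup>-\<^sup>2\<^sup>s\<close>. There are at most \<open>card Y (D s)\<^sup>n\<close> classes, so more points than
        that still fit into the ball.\<close>
      define D where "D = 2 * (C1 + C2 + 1)"
      have D: "D \<ge> 0" using C by (simp add: D_def)
      have "((\<lambda>s. 2 * \<bar>c\<bar> * (s ^ 0 / exp s) + norm v * real (card Y) * D ^ n * (s ^ n / exp s)) \<longlongrightarrow>
          2 * \<bar>c\<bar> * 0 + norm v * real (card Y) * D ^ n * 0) at_top"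
        by (intro tendsto_intros tendsto_power_div_exp_0)
      then have "\<forall>\<^sub>F s in at_top. 2 * \<bar>c\<bar> * (s ^ 0 / exp s) + norm v * real (card Y) * D ^ n * (s ^ n / exp s) < min e r0"
        using e b0(1) by (intro order_tendstoD(2)) auto
      then obtain s where s: "s \<ge> max 1 t0"
        and small: "2 * \<bar>c\<bar> * (s ^ 0 / exp s) + norm v * real (card Y) * D ^ n * (s ^ n / exp s) < min e r0"
        using eventually_happens'[OF trivial_limit_at_top_linorder
            eventually_conj[OF eventually_ge_at_top[of "max 1 t0"]]] by blast
      define t where "t = 2 * s"
      define h where "h = exp (- s)"
      have h: "h > 0" "exp (- t) = h\<^sup>2" by (simp_all add: h_def t_def power2_eq_square flip: exp_add)
      have t: "t \<ge> t0" "t \<ge> 0" using s by (auto simp: t_def)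
      define P where "P = nat \<lfloor>C1 + C2 * t\<rfloor>"
      \<comment> \<open>The class of an approximation: its offset and its multiplicities in \<open>J\<close>.\<close>
      define labels where "labels = Y \<times> (PiE J (\<lambda>_. {..P}))"
      define N where "N = card labels"
      have finlab: "finite labels" unfolding labels_def using Y finJ by (intro finite_cartesian_product finite_PiE) auto
      have Nle: "real N \<le> real (card Y) * (D ^ n * s ^ n)"
      proof -
        have "real P + 1 \<le> C1 + C2 * t + 1" using C t by (simp add: P_def)
        also have "\<dots> \<le> C1 * (2 * s) + C2 * (2 * s) + 2 * s" using s C mult_left_mono[of 1 "2 * s" C1] by (intro add_mono) (auto simp: t_def)
        also have "\<dots> = D * s" by (simp add: D_def algebra_simps)
        finally have "(real P + 1) ^ n \<le> (D * s) ^ n" by (intro power_mono) auto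
        moreover have "real N = real (card Y) * (real P + 1) ^ n"
          by (simp add: N_def labels_def card_cartesian_product card_PiE finJ n_def add.commute)
        ultimately show ?thesis by (simp add: power_mult_distrib mult_left_mono)
      qed
      have "norm v * (real N * h) \<le> norm v * (real (card Y) * (D ^ n * s ^ n) * h)"
        using Nle h by (intro mult_left_mono mult_right_mono) auto
      also have "\<dots> = norm v * real (card Y) * D ^ n * (s ^ n / exp s)"
        by (simp add: h_def exp_minus field_simps)
      finally have sm: "2 * \<bar>c\<bar> * h + norm v * (real N * h) < min e r0"
        using small by (simp add: h_def exp_minus field_simps)
      have Nh: "norm v * (real N * h) < r0"
      proof -
        have "2 * \<bar>c\<bar> * h \<ge> 0" using h by simp
        then show ?thesis using sm by linarith
      qed
      define b where "b j = b0 + (real j * h) *\<^sub>R v" for j :: nat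
      have bj: "norm (b j - b0) < r0" if "j \<le> N" for j
      proof -
        have "norm (b j - b0) = norm v * (real j * h)" using h by (simp add: b_def abs_mult)
        also have "\<dots> \<le> norm v * (real N * h)" using that h by (intro mult_left_mono mult_right_mono) auto
        finally show ?thesis using Nh by simp
      qed
      have "\<exists>y p l. y \<in> Y \<and> l \<in> \<Lambda> \<and> norm (b j - (y + (combination p + l) - t *\<^sub>R u)) \<le> c * exp (- t)"
        if "j \<le> N" for j
      proof -
        have "b j \<in> B" using bj[OF that] b0(2) by (auto simp: dist_norm norm_minus_commute)
        from fine[OF t(1) this] show ?thesis unfolding Q_def by blast
      qed
      then obtain y p l where ypl: "\<And>j. j \<le> N \<Longrightarrow> y j \<in> Y" "\<And>j. j \<le> N \<Longrightarrow> l j \<in> \<Lambda>"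
        "\<And>j. j \<le> N \<Longrightarrow> norm (b j - (y j + (combination (p j) + l j) - t *\<^sub>R u)) \<le> c * exp (- t)"
        by metis
      define label where "label j = (y j, restrict (p j) J)" for j
      have "label ` {..N} \<subseteq> labels"
      proof (rule image_subsetI)
        fix j assume "j \<in> {..N}"
        then have "j \<le> N" by simp
        have "p j f \<le> P" if "f \<in> J" for f
          using bound[OF that t(2) bj ypl(1,2,3)] \<open>j \<le> N\<close> unfolding P_def
          by (metis le_nat_floor)
        then show "label j \<in> labels" using ypl(1) \<open>j \<le> N\<close> by (auto simp: label_def labels_def)
      qed
      then have "card (label ` {..N}) \<le> N" unfolding N_def using finlab by (intro card_mono)
      then have "\<not> inj_on label {..N}" by (intro pigeonhole) simp
      then obtain i j where ij: "i < j" "j \<le> N" "label i = label j"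
        unfolding inj_on_def by (metis atMost_iff linorder_neqE_nat)
      define \<gamma> where "\<gamma> = (\<Sum>f\<in>F. of_int (int (p j f) - int (p i f)) *\<^sub>R X f) + (l j - l i)"
      have yij: "y i = y j" using ij(3) by (simp add: label_def)
      have pij: "p i f = p j f" if "f \<in> J" for f
        using ij(3) that unfolding label_def by (metis prod.inject restrict_apply')
      have "l j - l i \<in> \<Lambda>" using period_add[OF ypl(2) period_minus[OF ypl(2)], of j i] ij by simp
      then have \<gamma>Q: "\<gamma> \<in> closure Q" unfolding \<gamma>_def using pij by (intro group) auto
      define \<rho> where "\<rho> = real (j - i) * h"
      have \<rho>: "h \<le> \<rho>" "\<rho> \<le> real N * h" "\<rho> > 0"
        using ij h by (auto simp: \<rho>_def)
      have "\<gamma> = (combination (p j) + l j) - (combination (p i) + l i)"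
        by (simp add: \<gamma>_def combination_def scaleR_left_diff_distrib sum_subtractf)
      then have "\<gamma> - \<rho> *\<^sub>R v = (b i - (y i + (combination (p i) + l i) - t *\<^sub>R u)) - (b j - (y j + (combination (p j) + l j) - t *\<^sub>R u))"
        using ij by (simp add: yij b_def \<rho>_def of_nat_diff algebra_simps)
      then have "norm (\<gamma> - \<rho> *\<^sub>R v) \<le> norm (b i - (y i + (combination (p i) + l i) - t *\<^sub>R u)) + norm (b j - (y j + (combination (p j) + l j) - t *\<^sub>R u))"
        by (metis norm_triangle_ineq4)
      also have "\<dots> \<le> c * exp (- t) + c * exp (- t)"
        using ypl(3)[of i] ypl(3)[of j] ij by simp
      also have "\<dots> \<le> 2 * \<bar>c\<bar> * h\<^sup>2" unfolding h(2) by (simp add: mult_right_mono)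
      finally have \<gamma>: "norm (\<gamma> - \<rho> *\<^sub>R v) \<le> 2 * \<bar>c\<bar> * h\<^sup>2" .
      \<comment> \<open>The multiple of \<open>\<gamma>\<close> that is nearest to \<open>v\<close>, up to rounding.\<close>
      define m where "m = nat \<lfloor>1 / \<rho>\<rfloor>"
      have m: "real m \<le> 1 / \<rho>" "1 / \<rho> < real m + 1" using \<rho>(3) by (auto simp: m_def)
      have m1: "\<bar>real m * \<rho> - 1\<bar> \<le> \<rho>" using m \<rho>(3) by (simp add: field_simps abs_if)
      have mh: "real m * h \<le> 1"
        using m(1) \<rho> by (smt (verit) field_simps mult_left_mono of_nat_0_le_iff)
      have "real m *\<^sub>R \<gamma> - v = real m *\<^sub>R (\<gamma> - \<rho> *\<^sub>R v) + (real m * \<rho> - 1) *\<^sub>R v"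
        by (simp add: algebra_simps)
      then have "norm (real m *\<^sub>R \<gamma> - v) \<le> real m * norm (\<gamma> - \<rho> *\<^sub>R v) + \<bar>real m * \<rho> - 1\<bar> * norm v"
        by (metis (no_types, lifting) abs_of_nat norm_scaleR norm_triangle_ineq)
      also have "\<dots> \<le> real m * (2 * \<bar>c\<bar> * h\<^sup>2) + \<rho> * norm v"
        using \<gamma> m1 by (intro add_mono mult_left_mono mult_right_mono) auto
      also have "real m * (2 * \<bar>c\<bar> * h\<^sup>2) = (2 * \<bar>c\<bar> * h) * (real m * h)"
        by (simp add: power2_eq_square)
      also have "\<dots> \<le> (2 * \<bar>c\<bar> * h) * 1" using mh h by (intro mult_left_mono) auto
      also have "\<rho> * norm v \<le> norm v * (real N * h)" using mult_left_mono[OF \<rho>(2), of "norm v"] by (simp add: mult.commute)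
      finally have "norm (real m *\<^sub>R \<gamma> - v) < e" using sm by simp
      moreover have "real m *\<^sub>R \<gamma> \<in> closure Q" using closure_Q_nat_multiple[OF \<gamma>Q] .
      ultimately obtain z where "z \<in> Q" "dist z (real m *\<^sub>R \<gamma>) < e"
        using e unfolding closure_approachable by blast
      then have "dist z v < e'"
        using \<open>norm (real m *\<^sub>R \<gamma> - v) < e\<close> dist_triangle_half_l[of z "real m *\<^sub>R \<gamma>" e' v]
        by (simp add: dist_norm e_def norm_minus_commute)
      then show "\<exists>z\<in>Q. dist z v < e'" using \<open>z \<in> Q\<close> by blast
    qed
  qed
  then show ?thesis by blast
qed

end

section \<open>Exponentials and units in a commutative algebra\<close>

text \<open>The norm of the Euclidean space need not be submultiplicative. The exponential is therefore
  obtained from the regular representation \<open>L\<close> of the algebra on itself.\<close>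

locale commutative_algebra =
  fixes mul :: "'a::euclidean_space \<Rightarrow> 'a \<Rightarrow> 'a" (infixl \<open>\<star>\<close> 70) and e :: 'a
  assumes mul_bilinear: "bilinear (\<star>)"
    and mul_commute: "x \<star> y = y \<star> x"
    and mul_assoc: "(x \<star> y) \<star> z = x \<star> (y \<star> z)"
    and mul_unit: "e \<star> x = x"
begin

lemma mul_bounded_bilinear: "bounded_bilinear (\<star>)"
  using mul_bilinear bilinear_conv_bounded_bilinear by blast

sublocale mul: bounded_bilinear "(\<star>)" by (rule mul_bounded_bilinear)

lemma mul_left_commute: "x \<star> (y \<star> z) = y \<star> (x \<star> z)"
  by (metis mul_assoc mul_commute)

lemmas mul_ac = mul_assoc mul_commute mul_left_commute

lemma mul_unit_right: "x \<star> e = x"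
  using mul_unit mul_commute by metis

definition L :: "'a \<Rightarrow> ('a \<Rightarrow>\<^sub>L 'a)"
  where "L x = Blinfun ((\<star>) x)"

lemma L_apply [simp]: "blinfun_apply (L x) y = x \<star> y"
  by (simp add: L_def bounded_linear_Blinfun_apply mul.bounded_linear_right)

lemma L_add: "L (x + y) = L x + L y"
  by (rule blinfun_eqI) (simp add: blinfun.bilinear_simps mul.add_left)

lemma L_scaleR: "L (r *\<^sub>R x) = r *\<^sub>R L x"
  by (rule blinfun_eqI) (simp add: blinfun.bilinear_simps mul.scaleR_left)

lemma L_e: "L e = id_blinfun"
  by (rule blinfun_eqI) (simp add: mul_unit)

lemma L_0: "L 0 = 0"
  by (rule blinfun_eqI) (simp add: mul.zero_left)

lemma L_compose_commute: "L x o\<^sub>L L y = L y o\<^sub>L L x"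
  by (rule blinfun_eqI) (simp add: mul_left_commute)

definition Exp :: "'a \<Rightarrow> 'a"
  where "Exp x = blinfun_apply (operator_exp (L x)) e"

text \<open>An operator that commutes with all multiplications is the multiplication by its value at \<open>e\<close>.\<close>

lemma operator_exp_L: "blinfun_apply (operator_exp (L x)) z = Exp x \<star> z"
proof -
  have "operator_exp (L x) o\<^sub>L L z = L z o\<^sub>L operator_exp (L x)"
    by (rule operator_exp_commute[OF L_compose_commute])
  then have "blinfun_apply (operator_exp (L x) o\<^sub>L L z) e = blinfun_apply (L z o\<^sub>L operator_exp (L x)) e"
    by (rule arg_cong)
  then have "blinfun_apply (operator_exp (L x)) z = z \<star> Exp x"
    by (simp add: Exp_def mul_unit_right)
  then show ?thesis by (metis mul_commute)
qed

lemma Exp_0: "Exp 0 = e"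
  by (simp add: Exp_def L_0 operator_exp_0)

lemma Exp_add: "Exp (x + y) = Exp x \<star> Exp y"
  by (simp add: Exp_def[of "x + y"] L_add operator_exp_add[OF L_compose_commute] operator_exp_L mul_unit_right)

lemma Exp_scaleR_e: "Exp (t *\<^sub>R e) = exp t *\<^sub>R e"
  by (simp add: Exp_def L_scaleR L_e operator_exp_scaleR_id scaleR_blinfun.rep_eq)

lemma Exp_minus: "Exp x \<star> Exp (- x) = e"
  using Exp_add[of x "- x"] by (simp add: Exp_0)

lemma Exp_cancel: "Exp x = Exp y \<Longrightarrow> Exp (x - y) = e"
  using Exp_add[of x "- y"] Exp_minus[of y] by simp

lemma Exp_first_order:
  assumes "\<epsilon> > 0"
  obtains \<delta> where "\<delta> > 0" "\<And>x. norm x < \<delta> \<Longrightarrow> norm (Exp x - e - x) \<le> \<epsilon> * norm x"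
proof -
  obtain K where K: "K > 0" "\<And>x y. norm (x \<star> y) \<le> norm x * norm y * K"
    using mul.pos_bounded by blast
  have nL: "norm (L x) \<le> K * norm x" for x
  proof (rule norm_blinfun_bound)
    show "norm (blinfun_apply (L x) y) \<le> K * norm x * norm y" for y
      using K(2)[of x y] by (simp add: mult.commute mult.left_commute)
  qed (use K in simp)
  define k where "k = K\<^sup>2 * norm e + 1"
  have k: "k > 0" by (simp add: k_def add_nonneg_pos)
  have *: "norm (Exp x - e - x) \<le> k * norm x * norm x" if "norm x * K \<le> 1" for x
  proof -
    have "Exp x - e - x = blinfun_apply (operator_exp (L x) - id_blinfun - L x) e"
      by (simp add: Exp_def blinfun.bilinear_simps mul_unit_right)
    also have "norm \<dots> \<le> norm (operator_exp (L x) - id_blinfun - L x) * norm e" by (rule norm_blinfun)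
    also have "\<dots> \<le> (norm (L x))\<^sup>2 * norm e"
      using nL[of x] that by (intro mult_right_mono operator_exp_first_order) (auto simp: mult.commute)
    also have "\<dots> \<le> (K * norm x)\<^sup>2 * norm e"
      using nL by (intro mult_right_mono power_mono) auto
    also have "\<dots> \<le> k * norm x * norm x"
      by (simp add: k_def power2_eq_square algebra_simps)
    finally show ?thesis .
  qed
  show thesis
  proof (rule that)
    show "min (1 / K) (\<epsilon> / k) > 0" using K k \<open>\<epsilon> > 0\<close> by simp
    fix x :: 'a assume x: "norm x < min (1 / K) (\<epsilon> / k)"
    then have "norm x * K \<le> 1" "k * norm x \<le> \<epsilon>" using K k by (simp_all add: field_simps)
    then show "norm (Exp x - e - x) \<le> \<epsilon> * norm x"
      using *[of x] by (meson mult_right_mono norm_ge_zero order_trans)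
  qed
qed

lemma Exp_has_derivative_0: "(Exp has_derivative id) (at 0)"
  unfolding has_derivative_at_alt
proof (intro conjI allI impI)
  show "bounded_linear (id :: 'a \<Rightarrow> 'a)" by (simp add: id_def bounded_linear_ident)
  fix \<epsilon> :: real assume "\<epsilon> > 0"
  from Exp_first_order[OF this] obtain \<delta> where "\<delta> > 0" "\<And>x. norm x < \<delta> \<Longrightarrow> norm (Exp x - e - x) \<le> \<epsilon> * norm x"
    by metis
  then show "\<exists>d>0. \<forall>y. norm (y - 0) < d \<longrightarrow> norm (Exp y - Exp 0 - id (y - 0)) \<le> \<epsilon> * norm (y - 0)"
    by (auto simp: Exp_0)
qed

lemma continuous_on_Exp: "continuous_on A Exp"
proof (rule continuous_at_imp_continuous_on, rule ballI)
  fix x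
  have "isCont Exp 0" using Exp_has_derivative_0 has_derivative_continuous by blast
  then have "((\<lambda>h. Exp x \<star> Exp h) \<longlongrightarrow> Exp x \<star> e) (at 0)"
    by (intro mul.tendsto tendsto_const) (simp add: isCont_def Exp_0)
  then have "(\<lambda>h. Exp (x + h)) \<midarrow>0\<rightarrow> Exp x" by (simp add: Exp_add mul_unit_right)
  then show "isCont Exp x" by (simp add: isCont_iff)
qed

text \<open>The derivative of \<open>Exp\<close> at \<open>0\<close> is the identity, so Sussmann's open mapping theorem applies. It
  needs differentiability at the single point \<open>0\<close>.\<close>

lemma Exp_local_surjectivity:
  assumes "\<delta> > 0"
  obtains \<eta> where "\<eta> > 0" "ball e \<eta> \<subseteq> Exp ` ball 0 \<delta>"
proof -
  have "Exp 0 \<in> interior (Exp ` ball 0 \<delta>)"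
    by (rule sussmann_open_mapping[OF open_UNIV continuous_on_Exp UNIV_I Exp_has_derivative_0 bounded_linear_ident])
       (auto simp: assms fun_eq_iff)
  then show thesis using that unfolding mem_interior Exp_0 by blast
qed

definition unit :: "'a \<Rightarrow> bool"
  where "unit x \<longleftrightarrow> (\<exists>y. x \<star> y = e)"

lemma unit_mul: "unit x \<Longrightarrow> unit y \<Longrightarrow> unit (x \<star> y)"
  unfolding unit_def by (metis mul_assoc mul_commute mul_unit_right)

lemma unit_e: "unit e" using mul_unit by (auto simp: unit_def)

lemma unit_Exp: "unit (Exp x)" using Exp_minus by (auto simp: unit_def)

lemma unit_cancel: "unit x \<Longrightarrow> x \<star> y = x \<star> z \<Longrightarrow> y = z"
  unfolding unit_def by (metis mul_assoc mul_commute mul_unit)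

lemma unit_if_injective:
  assumes "\<And>u. x \<star> u = 0 \<Longrightarrow> u = 0"
  shows "unit x"
proof -
  have lin: "linear ((\<star>) x)" using mul.bounded_linear_right bounded_linear.linear by blast
  have "inj ((\<star>) x)" using assms linear_injective_0[OF lin] by blast
  then have "surj ((\<star>) x)" using lin linear_injective_imp_surjective by blast
  then show ?thesis unfolding unit_def by (metis surjD)
qed

text \<open>The cosets of the image of \<open>Exp\<close>, which is the identity component of the group of units.\<close>

definition coset :: "'a \<Rightarrow> 'a set"
  where "coset a = range (\<lambda>x. a \<star> Exp x)"

lemma cosetI: "a \<star> Exp x \<in> coset a" by (auto simp: coset_def)

lemma self_in_coset: "a \<in> coset a"
  using cosetI[of a 0] by (simp add: Exp_0 mul_unit_right)

lemma connected_coset: "connected (coset a)"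
  unfolding coset_def
  by (intro connected_continuous_image continuous_on_Exp mul.continuous_on continuous_on_const connected_UNIV)

lemma coset_sym: "b \<in> coset a \<Longrightarrow> a \<in> coset b"
proof -
  assume "b \<in> coset a"
  then obtain x where "b = a \<star> Exp x" by (auto simp: coset_def)
  then have "b \<star> Exp (- x) = a" by (simp add: mul_assoc Exp_minus mul_unit_right)
  then show "a \<in> coset b" using cosetI by metis
qed

lemma coset_trans: "b \<in> coset a \<Longrightarrow> c \<in> coset b \<Longrightarrow> c \<in> coset a"
  unfolding coset_def by (auto simp: mul_assoc simp flip: Exp_add)

lemma open_coset:
  assumes "unit a"
  shows "open (coset a)"
proof -
  obtain \<eta> where \<eta>: "\<eta> > 0" "ball e \<eta> \<subseteq> Exp ` ball 0 1"
    using Exp_local_surjectivity[of 1] by auto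
  have "\<exists>T. open T \<and> z \<in> T \<and> T \<subseteq> coset a" if za: "z \<in> coset a" for z
  proof -
    obtain x where z: "z = a \<star> Exp x" using za by (auto simp: coset_def)
    have "unit z" unfolding z using assms unit_Exp by (rule unit_mul)
    then obtain y where y: "z \<star> y = e" by (auto simp: unit_def)
    define T where "T = (\<lambda>v. y \<star> v) -` ball e \<eta>"
    have "open T" unfolding T_def
      by (intro open_vimage open_ball mul.continuous_on continuous_on_const continuous_on_id)
    moreover have "z \<in> T" using y \<eta>(1) by (simp add: T_def mul_commute)
    moreover have "T \<subseteq> coset a"
    proof
      fix v assume "v \<in> T"
      then obtain h where "y \<star> v = Exp h" using \<eta>(2) by (auto simp: T_def)
      then have "v = z \<star> Exp h" by (metis y mul_assoc mul_unit)
      then show "v \<in> coset a" using coset_trans[OF za cosetI] by simp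
    qed
    ultimately show ?thesis by blast
  qed
  then show ?thesis by (subst open_subopen) blast
qed

text \<open>The cosets partition the units into open sets, so a connected set of units lies in one coset.\<close>

lemma connected_units_in_coset:
  assumes "connected T" "\<And>x. x \<in> T \<Longrightarrow> unit x" "a \<in> T"
  shows "T \<subseteq> coset a"
proof (rule ccontr)
  assume "\<not> T \<subseteq> coset a"
  then obtain b where b: "b \<in> T" "b \<notin> coset a" by blast
  define V where "V = (\<Union>c\<in>T - coset a. coset c)"
  have "open V" unfolding V_def using assms(2) open_coset by blast
  moreover have "coset a \<inter> V \<inter> T = {}" unfolding V_def using coset_sym coset_trans by blast
  moreover have "T \<subseteq> coset a \<union> V" unfolding V_def using self_in_coset by blast
  ultimately have "coset a \<inter> T = {} \<or> V \<inter> T = {}"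
    using connectedD[OF assms(1) open_coset[OF assms(2)[OF assms(3)]]] by blast
  then show False using assms(3) b self_in_coset unfolding V_def by blast
qed

text \<open>The powers \<open>a\<^sup>0, \<dots>, a\<^sup>d\<close>, where \<open>d\<close> is the dimension, cannot be independent. If two of them
  coincide, their difference is the relation, which has to be treated separately because dependence
  is a property of the set of the powers.\<close>

lemma annihilating_polynomial:
  obtains k n :: nat and q :: "nat \<Rightarrow> real" where "k \<le> n" "q k \<noteq> 0"
    "\<And>u. (\<Sum>i\<le>n. q i *\<^sub>R ((\<star>) a ^^ i) u) = 0"
proof -
  let ?n = "DIM('a)"
  define pw where "pw i = ((\<star>) a ^^ i) e" for i
  have pw: "((\<star>) a ^^ i) u = pw i \<star> u" for i u
    by (induction i) (auto simp: pw_def mul_unit mul_assoc)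
  have "\<exists>q k. k \<le> ?n \<and> q k \<noteq> 0 \<and> (\<Sum>i\<le>?n. q i *\<^sub>R pw i) = 0"
  proof (cases "inj_on pw {..?n}")
    case True
    then have "card (pw ` {..?n}) = ?n + 1" by (simp add: card_image)
    then have "dependent (pw ` {..?n})" by (intro dependent_biggerset) simp
    then obtain u v where uv: "v \<in> pw ` {..?n}" "u v \<noteq> 0" "(\<Sum>v\<in>pw ` {..?n}. u v *\<^sub>R v) = 0"
      by (subst (asm) dependent_finite) auto
    then obtain k where "k \<le> ?n" "v = pw k" by auto
    then show ?thesis using uv sum.reindex[OF True, of "\<lambda>v. u v *\<^sub>R v"]
      by (intro exI[of _ "\<lambda>i. u (pw i)"] exI[of _ k]) simp
  next
    case False
    then obtain i j where ij: "i \<le> ?n" "j \<le> ?n" "i \<noteq> j" "pw i = pw j" by (auto simp: inj_on_def)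
    have "(\<Sum>l\<le>?n. ((if l = i then 1 else 0) - (if l = j then 1 else 0)) *\<^sub>R pw l) = pw i - pw j"
      using ij by (simp add: scaleR_left_diff_distrib sum_subtractf if_distrib[of "\<lambda>x. x *\<^sub>R _"] sum.delta cong: if_cong)
    then show ?thesis using ij
      by (intro exI[of _ "\<lambda>l. (if l = i then 1 else 0) - (if l = j then 1 else 0)"] exI[of _ i]) simp
  qed
  then obtain q k where qk: "k \<le> ?n" "q k \<noteq> (0::real)" "(\<Sum>i\<le>?n. q i *\<^sub>R pw i) = 0" by blast
  have "(\<Sum>i\<le>?n. q i *\<^sub>R ((\<star>) a ^^ i) u) = (\<Sum>i\<le>?n. q i *\<^sub>R pw i) \<star> u" for u
    by (simp add: pw mul.sum_left mul.scaleR_left)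
  then have "(\<Sum>i\<le>?n. q i *\<^sub>R ((\<star>) a ^^ i) u) = 0" for u
    using qk(3) by (simp add: mul.zero_left)
  then show thesis using that[where q = q, OF qk(1,2)] by blast
qed

text \<open>Let \<open>w\<close> be a non-real number. On a nonzero vector that is annihilated by
  \<open>a\<^sup>2 - 2 (Re w) a + |w|\<^sup>2\<close>, the powers of \<open>a\<close> obey the recursion of the powers of \<open>w\<close>. So every real
  polynomial that annihilates \<open>a\<close> vanishes at \<open>w\<close>.\<close>

lemma finitely_many_singular_quadratics:
  "finite {w. Im w > 0 \<and> (\<exists>u. u \<noteq> 0 \<and> a \<star> (a \<star> u) = (2 * Re w) *\<^sub>R (a \<star> u) - (cmod w)\<^sup>2 *\<^sub>R u)}"
proof -
  obtain k n :: nat and q :: "nat \<Rightarrow> real" where q: "k \<le> n" "q k \<noteq> 0"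
    "\<And>u. (\<Sum>i\<le>n. q i *\<^sub>R ((\<star>) a ^^ i) u) = 0" by (rule annihilating_polynomial[where a = a]) (rule that)
  have "(\<Sum>i\<le>n. complex_of_real (q i) * w ^ i) = 0"
    if w: "Im w > 0" and u: "u \<noteq> 0" and eq: "a \<star> (a \<star> u) = (2 * Re w) *\<^sub>R (a \<star> u) - (cmod w)\<^sup>2 *\<^sub>R u" for w u
  proof -
    have w2: "w * w = of_real (2 * Re w) * w - of_real ((cmod w)\<^sup>2)"
      unfolding complex_eq_iff cmod_power2 by (simp add: power2_eq_square)
    have "\<exists>\<alpha> \<beta>. w ^ i = of_real \<alpha> * w + of_real \<beta> \<and> ((\<star>) a ^^ i) u = \<alpha> *\<^sub>R (a \<star> u) + \<beta> *\<^sub>R u" for i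
    proof (induction i)
      case 0
      show ?case by (intro exI[of _ 0] exI[of _ 1]) simp
    next
      case (Suc i)
      then obtain \<alpha> \<beta> where ab: "w ^ i = of_real \<alpha> * w + of_real \<beta>" "((\<star>) a ^^ i) u = \<alpha> *\<^sub>R (a \<star> u) + \<beta> *\<^sub>R u"
        by blast
      have "w ^ Suc i = of_real \<alpha> * (w * w) + of_real \<beta> * w" by (simp add: ab algebra_simps)
      also have "\<dots> = of_real (\<alpha> * (2 * Re w) + \<beta>) * w + of_real (- \<alpha> * (cmod w)\<^sup>2)"
        unfolding w2 by (simp add: algebra_simps)
      finally have 1: "w ^ Suc i = \<dots>" .
      have "((\<star>) a ^^ Suc i) u = \<alpha> *\<^sub>R (a \<star> (a \<star> u)) + \<beta> *\<^sub>R (a \<star> u)"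
        by (simp add: ab mul.add_right mul.scaleR_right)
      also have "\<dots> = (\<alpha> * (2 * Re w) + \<beta>) *\<^sub>R (a \<star> u) + (- \<alpha> * (cmod w)\<^sup>2) *\<^sub>R u"
        unfolding eq by (simp add: algebra_simps)
      finally show ?case using 1 by blast
    qed
    then obtain \<alpha> \<beta> where ab: "\<And>i. w ^ i = of_real (\<alpha> i) * w + of_real (\<beta> i)"
      "\<And>i. ((\<star>) a ^^ i) u = \<alpha> i *\<^sub>R (a \<star> u) + \<beta> i *\<^sub>R u" by metis
    define A where "A = (\<Sum>i\<le>n. q i * \<alpha> i)"
    define B where "B = (\<Sum>i\<le>n. q i * \<beta> i)"
    have p: "(\<Sum>i\<le>n. complex_of_real (q i) * w ^ i) = of_real A * w + of_real B"
      by (simp add: ab(1) A_def B_def sum_distrib_left sum.distrib algebra_simps)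
    have "A *\<^sub>R (a \<star> u) + B *\<^sub>R u = (\<Sum>i\<le>n. q i *\<^sub>R ((\<star>) a ^^ i) u)"
      by (simp add: ab(2) A_def B_def scaleR_sum_left sum.distrib scaleR_right_distrib)
    also have "\<dots> = 0" by (rule q(3))
    finally have z: "A *\<^sub>R (a \<star> u) + B *\<^sub>R u = 0" .
    have "A = 0"
    proof (rule ccontr)
      assume "A \<noteq> 0"
      define r where "r = - B / A"
      have "A *\<^sub>R (a \<star> u) = - (B *\<^sub>R u)" using z by (simp add: eq_neg_iff_add_eq_0)
      then have "inverse A *\<^sub>R (A *\<^sub>R (a \<star> u)) = inverse A *\<^sub>R (- (B *\<^sub>R u))" by simp
      then have au: "a \<star> u = r *\<^sub>R u" using \<open>A \<noteq> 0\<close> by (simp add: r_def field_simps)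
      have "(r * r - 2 * Re w * r + (cmod w)\<^sup>2) *\<^sub>R u = 0"
        using eq by (simp add: au mul.scaleR_right algebra_simps)
      then have "r * r - 2 * Re w * r + (cmod w)\<^sup>2 = 0" using u by simp
      moreover have "r * r - 2 * Re w * r + (cmod w)\<^sup>2 = (r - Re w)\<^sup>2 + (Im w)\<^sup>2"
        unfolding cmod_power2 by (simp add: power2_eq_square algebra_simps)
      ultimately show False using w by (simp add: sum_power2_eq_zero_iff)
    qed
    then show ?thesis using z u p by simp
  qed
  moreover have "finite {z. (\<Sum>i\<le>n. complex_of_real (q i) * z ^ i) = 0}"
    using q(1,2) by (subst polyfun_finite_roots) auto
  ultimately show ?thesis by (auto elim: finite_subset[rotated])
qed

text \<open>The units \<open>(1 - s)\<^sup>2 a\<^sup>2 - 2 s (1 - s) c a + s\<^sup>2 (c\<^sup>2 + 1)\<close> connect \<open>a\<^sup>2\<close> to a positive scalar. For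
  \<open>s < 1\<close> this is, up to a factor, the quadratic with the roots \<open>w\<close> and \<open>cnj w\<close> for
  \<open>w = s / (1 - s) (c + \<i>)\<close>, so it is invertible if \<open>c\<close> avoids finitely many values.\<close>

lemma square_of_unit:
  assumes "unit a"
  obtains x where "Exp x = a \<star> a"
proof -
  define W where "W = {w. Im w > 0 \<and> (\<exists>u. u \<noteq> 0 \<and> a \<star> (a \<star> u) = (2 * Re w) *\<^sub>R (a \<star> u) - (cmod w)\<^sup>2 *\<^sub>R u)}"
  have "finite W" unfolding W_def by (rule finitely_many_singular_quadratics)
  then obtain c where c: "c \<notin> (\<lambda>w. Re w / Im w) ` W"
    using ex_new_if_finite[of "(\<lambda>w. Re w / Im w) ` W"] infinite_UNIV_char_0 by blast
  define g where "g s = (1 - s)\<^sup>2 *\<^sub>R (a \<star> a) - (2 * s * (1 - s) * c) *\<^sub>R a + (s\<^sup>2 * (c\<^sup>2 + 1)) *\<^sub>R e" for s :: real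
  have "unit (g s)" if s: "s \<in> {0..1}" for s
  proof (cases "s = 0")
    case True
    then show ?thesis using unit_mul[OF assms assms] by (simp add: g_def)
  next
    case s0: False
    show ?thesis
    proof (rule unit_if_injective, rule ccontr)
      fix u assume gu: "g s \<star> u = 0" and u: "u \<noteq> 0"
      have "g s \<star> u = (1 - s)\<^sup>2 *\<^sub>R (a \<star> (a \<star> u)) - (2 * s * (1 - s) * c) *\<^sub>R (a \<star> u) + (s\<^sup>2 * (c\<^sup>2 + 1)) *\<^sub>R u"
        by (simp add: g_def mul.add_left mul.diff_left mul.scaleR_left mul_assoc mul_unit)
      then have q: "(1 - s)\<^sup>2 *\<^sub>R (a \<star> (a \<star> u)) = (2 * s * (1 - s) * c) *\<^sub>R (a \<star> u) - (s\<^sup>2 * (c\<^sup>2 + 1)) *\<^sub>R u"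
        using gu by (simp add: algebra_simps)
      have s1: "s \<noteq> 1"
      proof
        assume "s = 1"
        then have "(c\<^sup>2 + 1) *\<^sub>R u = 0" using q by simp
        then show False using u by (simp add: add_nonneg_eq_0_iff)
      qed
      define r where "r = s / (1 - s)"
      define d where "d = 1 - s"
      have d: "d \<noteq> 0" using s1 by (simp add: d_def)
      have r: "r > 0" using s s0 s1 by (simp add: r_def)
      define w where "w = Complex (r * c) r"
      have "a \<star> (a \<star> u) = inverse ((1 - s)\<^sup>2) *\<^sub>R ((1 - s)\<^sup>2 *\<^sub>R (a \<star> (a \<star> u)))" using s1 by simp
      also have "\<dots> = (inverse ((1 - s)\<^sup>2) * (2 * s * (1 - s) * c)) *\<^sub>R (a \<star> u) - (inverse ((1 - s)\<^sup>2) * (s\<^sup>2 * (c\<^sup>2 + 1))) *\<^sub>R u"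
        unfolding q by (simp add: scaleR_right_diff_distrib)
      also have "inverse ((1 - s)\<^sup>2) * (2 * s * (1 - s) * c) = 2 * Re w"
        using d by (simp add: w_def r_def power2_eq_square field_simps flip: d_def)
      also have "inverse ((1 - s)\<^sup>2) * (s\<^sup>2 * (c\<^sup>2 + 1)) = (cmod w)\<^sup>2"
        using d unfolding cmod_power2
        by (simp add: w_def r_def power2_eq_square field_simps flip: d_def)
      finally have "w \<in> W" unfolding W_def using u r by (auto simp: w_def)
      moreover have "Re w / Im w = c" using r by (simp add: w_def)
      ultimately show False using c by blast
    qed
  qed
  moreover have "connected (g ` {0..1})"
    unfolding g_def by (intro connected_continuous_image continuous_intros) auto
  ultimately have "g ` {0..1} \<subseteq> coset (g 0)"
    by (intro connected_units_in_coset) auto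
  then have "g 1 \<in> coset (g 0)" by auto
  then obtain x where "(c\<^sup>2 + 1) *\<^sub>R e = (a \<star> a) \<star> Exp x" by (auto simp: coset_def g_def)
  moreover have "(c\<^sup>2 + 1) *\<^sub>R e = Exp (ln (c\<^sup>2 + 1) *\<^sub>R e)"
    by (simp add: Exp_scaleR_e add_nonneg_pos)
  ultimately have "Exp (ln (c\<^sup>2 + 1) *\<^sub>R e - x) = a \<star> a"
    using Exp_add[of "ln (c\<^sup>2 + 1) *\<^sub>R e" "- x"] by (simp add: mul_assoc Exp_minus mul_unit_right)
  then show thesis by (rule that)
qed

lemma linear_L: "linear L"
  by (rule linearI) (rule L_add L_scaleR)+

lemma bounded_linear_L: "bounded_linear L"
  using linear_L by (simp add: linear_conv_bounded_linear)

lemma L_apply_e: "blinfun_apply (L x) e = x"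
  by (simp add: mul_unit_right)

lemma L_mul: "L (x \<star> y) = L x o\<^sub>L L y"
  by (rule blinfun_eqI) (simp add: mul_assoc)

lemma bij_L_iff_unit: "bij (blinfun_apply (L x)) \<longleftrightarrow> unit x"
proof
  assume "bij (blinfun_apply (L x))"
  then obtain y where "blinfun_apply (L x) y = e" by (metis bij_pointE)
  then show "unit x" by (auto simp: unit_def)
next
  assume "unit x"
  then obtain y where "x \<star> y = e" by (auto simp: unit_def)
  then have "x \<star> (y \<star> z) = z" "y \<star> (x \<star> z) = z" for z
    by (metis mul_assoc mul_unit, metis mul_assoc mul_commute mul_unit)
  then show "bij (blinfun_apply (L x))"
    by (intro o_bij[of "blinfun_apply (L y)"]) (simp_all add: fun_eq_iff)
qed

lemma subspace_range_L: "subspace (range L)"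
  using linear_subspace_image[OF linear_L subspace_UNIV] .

lemma dim_range_L: "dim (range L) = DIM('a)"
proof -
  have inj: "inj L" by (metis L_apply_e injI)
  have "span (range L) = range L" using subspace_range_L by (rule span_eq_iff[THEN iffD2])
  moreover have "span (L ` Basis) = range L" by (simp add: linear_span_image[OF linear_L])
  ultimately have "span (L ` Basis) = span (range L)" by metis
  moreover have "independent (L ` Basis)"
    using linear_independent_injective_image[OF linear_L independent_Basis] inj
    by (simp add: inj_on_subset)
  ultimately have "dim (range L) = card (L ` Basis)" by (intro dim_eq_card)
  then show ?thesis using inj by (simp add: card_image inj_on_subset)
qed

inductive_set semigroup :: "'a set \<Rightarrow> 'a set" for F
  where
    generator: "f \<in> F \<Longrightarrow> f \<in> semigroup F"
  | product: "\<lbrakk>f \<in> semigroup F; g \<in> semigroup F\<rbrakk> \<Longrightarrow> f \<star> g \<in> semigroup F"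

end

section \<open>Semigroups of units\<close>

locale semigroup_of_units = commutative_algebra +
  fixes F :: "'a set" and X :: "'a \<Rightarrow> 'a"
  assumes finite_generators: "finite F"
    and Exp_X: "f \<in> F \<Longrightarrow> Exp (X f) = f \<star> f"
    and unit_generator: "f \<in> F \<Longrightarrow> unit f"
begin

abbreviation S :: "'a set" where "S \<equiv> semigroup F"

definition \<Lambda> :: "'a set" where "\<Lambda> = {x. Exp x = e}"

sublocale periodic_monoid F X \<Lambda>
proof
  show "0 \<in> \<Lambda>" by (simp add: \<Lambda>_def Exp_0)
  show "x + y \<in> \<Lambda>" if "x \<in> \<Lambda>" "y \<in> \<Lambda>" for x y using that by (simp add: \<Lambda>_def Exp_add mul_unit)
  show "- x \<in> \<Lambda>" if "x \<in> \<Lambda>" for x using that Exp_minus[of x] by (simp add: \<Lambda>_def mul_unit)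
qed (rule finite_generators)

lemma unit_S: "s \<in> S \<Longrightarrow> unit s"
  by (induction rule: semigroup.induct) (auto simp: unit_generator unit_mul)

lemma mul_S: "s \<in> S \<Longrightarrow> t \<in> insert e S \<Longrightarrow> s \<star> t \<in> S"
  by (auto simp: mul_unit_right semigroup.product)

lemma mul_Se: "s \<in> insert e S \<Longrightarrow> t \<in> insert e S \<Longrightarrow> s \<star> t \<in> insert e S"
  by (auto simp: mul_unit_right mul_unit semigroup.product)

text \<open>A multiple of \<open>X f\<close> with a natural factor is mapped to a power of \<open>f\<^sup>2\<close>, and a period to \<open>e\<close>.\<close>

lemma Exp_Q: "q \<in> Q \<Longrightarrow> Exp q \<in> insert e S"
proof -
  assume "q \<in> Q"
  then obtain p l where q: "q = combination p + l" "Exp l = e" unfolding Q_def by (auto simp: \<Lambda>_def)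
  have n: "Exp (real n *\<^sub>R X f) \<in> insert e S" if "f \<in> F" for n f
  proof (induction n)
    case (Suc n)
    have "Exp (real (Suc n) *\<^sub>R X f) = (f \<star> f) \<star> Exp (real n *\<^sub>R X f)"
      by (simp add: scaleR_left_distrib Exp_add Exp_X that)
    then show ?case using mul_Se[OF _ Suc, of "f \<star> f"] that semigroup.intros by auto
  qed (simp add: Exp_0)
  have "Exp (\<Sum>f\<in>G. real (p f) *\<^sub>R X f) \<in> insert e S" if "G \<subseteq> F" for G
    using finite_subset[OF that finite_generators] that
    by (induction G rule: finite_induct) (use Exp_0 Exp_add mul_Se n in auto)
  from this[OF order_refl] show "Exp q \<in> insert e S"
    by (simp add: q Exp_add mul_unit_right combination_def)
qed

text \<open>The squares of the generators are exponentials of the \<open>X f\<close>, so only the parities of the exponents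
  in a product of generators matter. Accordingly, \<open>R\<close> is built by taking up one generator \<open>g\<close> after the
  other and adding \<open>g R\<close> to \<open>R\<close>. What the induction maintains is that multiplication by the generators
  already taken up leads from \<open>R\<close> to \<open>R\<close>, up to exponentials.\<close>

lemma finite_representatives:
  obtains R where "finite R" "R \<subseteq> insert e S"
    "\<And>s. s \<in> S \<Longrightarrow> \<exists>r\<in>R. \<exists>p. s = r \<star> Exp (combination p)"
proof -
  define rep where "rep R x \<longleftrightarrow> (\<exists>r\<in>R. \<exists>p. x = r \<star> Exp (combination p))" for R x
  have repI: "rep R (r \<star> Exp (combination p))" if "r \<in> R" for R r p
    unfolding rep_def using that by blast
  have rep_mono: "rep R' x" if "rep R x" "R \<subseteq> R'" for R R' x
    using that unfolding rep_def by blast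
  have rep_e: "rep R r" if "r \<in> R" for R r
    using repI[OF that, of "\<lambda>_. 0"] by (simp add: combination_def Exp_0 mul_unit_right)
  have "\<exists>R. finite R \<and> e \<in> R \<and> R \<subseteq> insert e S \<and> (\<forall>f\<in>G. \<forall>r\<in>R. rep R (f \<star> r))" if "G \<subseteq> F" for G
    using finite_subset[OF that finite_generators] that
  proof (induction G rule: finite_induct)
    case empty
    show ?case by (intro exI[of _ "{e}"]) simp
  next
    case (insert g G)
    then have "\<exists>R. finite R \<and> e \<in> R \<and> R \<subseteq> insert e S \<and> (\<forall>f\<in>G. \<forall>r\<in>R. rep R (f \<star> r))" by simp
    then obtain R where R: "finite R" "e \<in> R" "R \<subseteq> insert e S" "\<And>f r. f \<in> G \<Longrightarrow> r \<in> R \<Longrightarrow> rep R (f \<star> r)"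
      by blast
    have g: "g \<in> F" using insert.prems by simp
    let ?R = "R \<union> (\<star>) g ` R"
    have "rep ?R (f \<star> r)" if fr: "f \<in> insert g G" "r \<in> ?R" for f r
    proof -
      consider "f = g" "r \<in> R" | r' where "f = g" "r' \<in> R" "r = g \<star> r'" | "f \<in> G" "r \<in> R"
        | r' where "f \<in> G" "r' \<in> R" "r = g \<star> r'"
        using fr by blast
      then show ?thesis
      proof cases
        case 1
        then show ?thesis by (intro rep_e) simp
      next
        case (2 r')
        have "combination (\<lambda>f. if f = g then 1 else 0) = X g"
          using g finite_generators
          by (simp add: combination_def if_distrib[of real] if_distrib[of "\<lambda>x. x *\<^sub>R _"] sum.delta cong: if_cong)
        then have "r' \<star> Exp (combination (\<lambda>f. if f = g then 1 else 0)) = r' \<star> (g \<star> g)"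
          by (simp only: Exp_X[OF g])
        also have "\<dots> = f \<star> r" unfolding 2 by (metis mul_assoc mul_commute)
        finally have "f \<star> r = r' \<star> Exp (combination (\<lambda>f. if f = g then 1 else 0))" ..
        moreover have "r' \<in> ?R" using 2(2) ..
        ultimately show ?thesis using repI[of r' ?R] by metis
      next
        case 3
        then show ?thesis using R(4) rep_mono[of R _ ?R] by blast
      next
        case (4 r')
        obtain r2 p where r2: "r2 \<in> R" "f \<star> r' = r2 \<star> Exp (combination p)"
          using R(4)[OF 4(1,2)] unfolding rep_def by blast
        have "f \<star> r = g \<star> (f \<star> r')" unfolding 4(3) by (rule mul_left_commute)
        then have "f \<star> r = (g \<star> r2) \<star> Exp (combination p)" by (simp add: r2(2) mul_assoc)
        moreover have "g \<star> r2 \<in> ?R" using r2(1) by blast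
        ultimately show ?thesis using repI[of "g \<star> r2" ?R] by metis
      qed
    qed
    moreover have "?R \<subseteq> insert e S"
      using R(3) mul_S[OF semigroup.generator[OF g]] by auto
    ultimately show ?case using R by (intro exI[of _ ?R]) simp
  qed
  from this[OF order_refl] obtain R where R: "finite R" "e \<in> R" "R \<subseteq> insert e S"
    "\<And>f r. f \<in> F \<Longrightarrow> r \<in> R \<Longrightarrow> rep R (f \<star> r)" by blast
  have "\<forall>r\<in>R. rep R (s \<star> r)" if "s \<in> S" for s
    using that
  proof (induction rule: semigroup.induct)
    case (generator f)
    then show ?case using R(4) by blast
  next
    case (product f g)
    show ?case
    proof
      fix r assume "r \<in> R"
      then obtain r1 p where 1: "r1 \<in> R" "g \<star> r = r1 \<star> Exp (combination p)"
        using product.IH(2) unfolding rep_def by blast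
      then obtain r2 q where 2: "r2 \<in> R" "f \<star> r1 = r2 \<star> Exp (combination q)"
        using product.IH(1) unfolding rep_def by blast
      have "(f \<star> g) \<star> r = (f \<star> r1) \<star> Exp (combination p)"
        using 1 by (simp add: mul_assoc)
      also have "\<dots> = r2 \<star> Exp (combination (\<lambda>f. q f + p f))"
        by (simp add: 2 mul_assoc combination_add Exp_add)
      finally show "rep R ((f \<star> g) \<star> r)" using 2(1) unfolding rep_def by blast
    qed
  qed
  then have "rep R s" if "s \<in> S" for s
    using R(2) that mul_unit_right[of s] by metis
  then show thesis using that R(1,3) unfolding rep_def by blast
qed

end

locale coarsely_dense_semigroup = semigroup_of_units +
  fixes C :: "'a set"
  assumes open_C: "open C" and C_nonempty: "C \<noteq> {}" and cone_C: "positive_cone C"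
    and coarse: "coarsely_dense_in (S \<inter> C) C"
begin

text \<open>Fix a point \<open>k\<close> of the semigroup in the cone and consider the points \<open>e\<^sup>t k Exp b\<close>, where \<open>b\<close> ranges
  over a small ball. They lie in the cone, so they are within a bounded distance of the semigroup.
  After division by \<open>e\<^sup>t k Exp b\<close>, the approximating member of the semigroup is at a distance of order
  \<open>e\<^sup>-\<^sup>t\<close> from \<open>e\<close>, so it is \<open>Exp x\<close> for some \<open>x\<close> of that order. Its logarithm \<open>b + x + t e\<close> (relative to
  \<open>k\<close>) is an element of \<open>Q\<close>, up to finitely many offsets that account for \<open>k\<close> and the representatives.\<close>

lemma closure_Q: "closure Q = UNIV"
proof -
  obtain D where D: "D > 0" "\<And>c. c \<in> C \<Longrightarrow> \<exists>s\<in>S \<inter> C. dist s c < D"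
    using coarse unfolding coarsely_dense_in_def by (auto simp: subset_iff)
  obtain k where k: "k \<in> S" "k \<in> C" using D(2) C_nonempty by blast
  have uk: "unit k" using unit_S k by blast
  then obtain k' where k': "k \<star> k' = e" by (auto simp: unit_def)
  have "open ((\<lambda>b. k \<star> Exp b) -` C)"
    by (intro open_vimage open_C mul.continuous_on continuous_on_const continuous_on_Exp)
  moreover have "0 \<in> (\<lambda>b. k \<star> Exp b) -` C" using k by (simp add: Exp_0 mul_unit_right)
  ultimately obtain \<delta>0 where \<delta>0: "\<delta>0 > 0" "\<And>b. norm b < \<delta>0 \<Longrightarrow> k \<star> Exp b \<in> C"
    unfolding open_contains_ball by (force simp: subset_iff)
  define B where "B = ball (0::'a) (min \<delta>0 1)"
  have B: "open B" "B \<noteq> {}" "\<And>b. b \<in> B \<Longrightarrow> norm b < \<delta>0 \<and> norm b < 1"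
    using \<delta>0 by (auto simp: B_def)
  have "bounded (Exp ` cball 0 1)"
    by (intro compact_imp_bounded compact_continuous_image continuous_on_Exp compact_cball)
  then obtain K0 where K0: "K0 > 0" "\<And>b. norm b \<le> 1 \<Longrightarrow> norm (Exp b) \<le> K0"
    unfolding bounded_pos by auto
  obtain K where K: "K > 0" "\<And>x y. norm (x \<star> y) \<le> norm x * norm y * K"
    using mul.pos_bounded by blast
  define M where "M = norm k' * (K0 * K) * K + 1"
  have M: "M > 0" using K0 K by (simp add: M_def add_nonneg_pos)
  have nM: "norm (k' \<star> (Exp (- b) \<star> v)) \<le> M * norm v" if "b \<in> B" for b v
  proof -
    have "norm (Exp (- b) \<star> v) \<le> norm (Exp (- b)) * norm v * K" by (rule K)
    also have "\<dots> \<le> K0 * norm v * K" using K0(2)[of "- b"] B(3)[OF that] K(1) by (intro mult_right_mono) auto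
    finally have "norm k' * norm (Exp (- b) \<star> v) * K \<le> norm k' * (K0 * norm v * K) * K"
      using K(1) by (intro mult_right_mono mult_left_mono) auto
    also have "\<dots> \<le> M * norm v" by (simp add: M_def algebra_simps)
    finally show ?thesis using K(2)[of k' "Exp (- b) \<star> v"] by linarith
  qed
  obtain \<delta>1 where \<delta>1: "\<delta>1 > 0" "\<And>x. norm x < \<delta>1 \<Longrightarrow> norm (Exp x - e - x) \<le> 1/2 * norm x"
    using Exp_first_order[of "1/2"] by auto
  obtain \<eta> where \<eta>: "\<eta> > 0" "ball e \<eta> \<subseteq> Exp ` ball 0 \<delta>1"
    using Exp_local_surjectivity[OF \<delta>1(1)] by blast
  obtain R where R: "finite R" "R \<subseteq> insert e S"
    "\<And>s. s \<in> S \<Longrightarrow> \<exists>r\<in>R. \<exists>p. s = r \<star> Exp (combination p)"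
    by (rule finite_representatives) (rule that)
  have uR: "unit r" if "r \<in> R" for r using that R(2) unit_S unit_e by blast
  \<comment> \<open>The offset of the representative \<open>r\<close>. The choice is arbitrary if \<open>k\<close> is not in the coset of
    \<open>r\<close>, in which case \<open>r\<close> does not occur below.\<close>
  define y where "y r = (SOME y. r \<star> Exp y = k)" for r
  show ?thesis
  proof (rule dense_if_exponentially_fine[of "(\<lambda>r. - y r) ` R" B "M * D / \<eta>" e "2 * (M * D)"])
    fix t b assume t: "t \<ge> M * D / \<eta>" and b: "b \<in> B"
    have et: "M * D * exp (- t) < \<eta>"
    proof -
      have "M * D / \<eta> < exp t" using t exp_ge_add_one_self[of t] by linarith
      then show ?thesis using \<eta>(1) by (simp add: exp_minus field_simps)
    qed
    define c where "c = exp t *\<^sub>R (k \<star> Exp b)"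
    have "c \<in> C" using cone_C \<delta>0(2) B(3)[OF b] unfolding c_def positive_cone_def by simp
    then obtain s where s: "s \<in> S" "norm (s - c) < D" using D(2) by (auto simp: dist_norm)
    define z where "z = exp (- t) *\<^sub>R (k' \<star> (Exp (- b) \<star> s))"
    have "k' \<star> (Exp (- b) \<star> c) = exp t *\<^sub>R ((k \<star> k') \<star> (Exp b \<star> Exp (- b)))"
      by (simp add: c_def mul.scaleR_right mul_ac)
    then have kc: "k' \<star> (Exp (- b) \<star> c) = exp t *\<^sub>R e" by (simp add: k' Exp_minus mul_unit)
    have "z - e = exp (- t) *\<^sub>R (k' \<star> (Exp (- b) \<star> (s - c)))"
      by (simp add: z_def mul.diff_right kc scaleR_right_diff_distrib flip: exp_add)
    then have "norm (z - e) = exp (- t) * norm (k' \<star> (Exp (- b) \<star> (s - c)))" by simp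
    also have "\<dots> \<le> exp (- t) * (M * D)"
      using nM[OF b, of "s - c"] s(2) M
      by (intro mult_left_mono order_trans[OF nM[OF b]]) auto
    finally have ze: "norm (z - e) \<le> M * D * exp (- t)" by (simp add: mult.commute)
    then have "z \<in> ball e \<eta>" using et by (simp add: dist_norm norm_minus_commute)
    then obtain x where x: "z = Exp x" "norm x < \<delta>1" using \<eta>(2) by auto
    have "norm x \<le> norm (z - e) + norm (z - e - x)"
      using norm_triangle_ineq4[of "z - e" "z - e - x"] by simp
    then have nx: "norm x \<le> 2 * (M * D) * exp (- t)" using \<delta>1(2)[OF x(2)] ze x(1) by simp
    have "k \<star> Exp (b + x + t *\<^sub>R e) = exp t *\<^sub>R (k \<star> (Exp b \<star> z))"
      by (simp add: Exp_add Exp_scaleR_e mul.scaleR_right mul_unit_right mul_assoc x(1))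
    also have "\<dots> = (k \<star> k') \<star> ((Exp b \<star> Exp (- b)) \<star> s)"
      by (simp add: z_def mul.scaleR_right mul_ac flip: exp_add)
    also have "\<dots> = s" by (simp add: k' Exp_minus mul_unit)
    finally have sk: "k \<star> Exp (b + x + t *\<^sub>R e) = s" .
    obtain r p where r: "r \<in> R" "s = r \<star> Exp (combination p)" using R(3)[OF s(1)] by blast
    have "r \<star> Exp (combination p - (b + x + t *\<^sub>R e)) = s \<star> Exp (- (b + x + t *\<^sub>R e))"
      by (simp only: diff_conv_add_uminus Exp_add[of "combination p"] r(2) mul_assoc)
    also have "\<dots> = k" unfolding sk[symmetric] mul_assoc Exp_minus by (rule mul_unit_right)
    finally have rk: "r \<star> Exp (combination p - (b + x + t *\<^sub>R e)) = k" .
    then have "r \<star> Exp (y r) = k" unfolding y_def by (rule someI)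
    then have "Exp (y r) = Exp (combination p - (b + x + t *\<^sub>R e))"
      using rk unit_cancel[OF uR[OF r(1)]] by metis
    then have l: "y r - (combination p - (b + x + t *\<^sub>R e)) \<in> \<Lambda>"
      using Exp_cancel by (simp add: \<Lambda>_def)
    define l where "l = y r - (combination p - (b + x + t *\<^sub>R e))"
    have "b - (- y r + (combination p + l) - t *\<^sub>R e) = - x"
      by (simp add: l_def)
    then have "norm (b - (- y r + (combination p + l) - t *\<^sub>R e)) \<le> 2 * (M * D) * exp (- t)"
      using nx by simp
    then show "\<exists>y\<in>(\<lambda>r. - y r) ` R. \<exists>q\<in>Q. norm (b - (y + q - t *\<^sub>R e)) \<le> 2 * (M * D) * exp (- t)"
      using r(1) QI l unfolding l_def by blast
  qed (use R B in auto)
qed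

text \<open>This turns out to be the closure of the semigroup in the group of units.\<close>

definition saturation :: "'a set" where "saturation = (\<Union>s\<in>S. coset s)"

lemma saturationE: "z \<in> saturation \<Longrightarrow> (\<And>s x. s \<in> S \<Longrightarrow> z = s \<star> Exp x \<Longrightarrow> thesis) \<Longrightarrow> thesis"
  unfolding saturation_def coset_def by blast

lemma saturationI: "s \<in> S \<Longrightarrow> s \<star> Exp x \<in> saturation"
  unfolding saturation_def coset_def by blast

lemma unit_saturation: "z \<in> saturation \<Longrightarrow> unit z"
  by (elim saturationE) (simp add: unit_mul unit_S unit_Exp)

lemma S_subset_saturation: "S \<subseteq> saturation"
  unfolding saturation_def using self_in_coset by blast

lemma coset_subset_saturation: "z \<in> saturation \<Longrightarrow> coset z \<subseteq> saturation"
  unfolding saturation_def using coset_trans by blast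

lemma open_saturation: "open saturation"
  unfolding saturation_def using open_coset unit_S by blast

text \<open>As \<open>Q\<close> is dense, so are the points \<open>s \<star> Exp q\<close> in the coset of \<open>s\<close>, and these are members of the
  semigroup.\<close>

lemma saturation_subset_closure: "saturation \<subseteq> closure S"
proof
  fix z assume "z \<in> saturation"
  then obtain s x where z: "s \<in> S" "z = s \<star> Exp x" by (rule saturationE)
  have "(\<lambda>q. s \<star> Exp q) ` closure Q \<subseteq> closure ((\<lambda>q. s \<star> Exp q) ` Q)"
    unfolding closure_Q
    by (rule image_closure_subset[of Q, unfolded closure_Q])
       (auto intro: mul.continuous_on continuous_on_const continuous_on_Exp closure_subset[THEN subsetD])
  also have "\<dots> \<subseteq> closure S"
    by (intro closure_mono) (use mul_S[OF z(1)] Exp_Q in auto)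
  finally show "z \<in> closure S" unfolding closure_Q z(2) by blast
qed

text \<open>The coset of \<open>z\<close> is a neighbourhood of \<open>z\<close>, so it contains a member of the semigroup.\<close>

lemma unit_in_closure: "z \<in> closure S \<Longrightarrow> unit z \<Longrightarrow> z \<in> saturation"
proof -
  assume z: "z \<in> closure S" "unit z"
  have "coset z \<inter> S \<noteq> {}"
    using open_Int_closure_eq_empty[OF open_coset[OF z(2)], of S] z(1) self_in_coset by blast
  then show "z \<in> saturation" unfolding saturation_def using coset_sym by blast
qed

lemma mul_saturation: "y \<in> saturation \<Longrightarrow> z \<in> saturation \<Longrightarrow> y \<star> z \<in> saturation"
proof -
  assume y: "y \<in> saturation" and z: "z \<in> saturation"
  obtain s x where "s \<in> S" "y = s \<star> Exp x" using y by (rule saturationE)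
  moreover obtain t w where "t \<in> S" "z = t \<star> Exp w" using z by (rule saturationE)
  ultimately have "y \<star> z = (s \<star> t) \<star> Exp (x + w)" "s \<star> t \<in> S"
    by (simp_all add: Exp_add mul_ac semigroup.product)
  then show "y \<star> z \<in> saturation" using saturationI by simp
qed

text \<open>If \<open>s\<^sup>2 = Exp y\<close>, then the inverse of \<open>s\<close> is \<open>s \<star> Exp (- y)\<close>.\<close>

lemma inverse_saturation: "z \<in> saturation \<Longrightarrow> \<exists>y\<in>saturation. z \<star> y = e"
proof -
  assume "z \<in> saturation"
  then obtain s x where z: "s \<in> S" "z = s \<star> Exp x" by (rule saturationE)
  obtain y where y: "Exp y = s \<star> s" using square_of_unit[OF unit_S[OF z(1)]] by blast
  have "z \<star> (s \<star> Exp (- x + - y)) = (s \<star> s) \<star> (Exp (- y) \<star> (Exp x \<star> Exp (- x)))"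
    unfolding z(2) Exp_add by (simp add: mul_ac)
  also have "\<dots> = e" by (simp add: Exp_minus mul_unit_right flip: y)
  finally show ?thesis using saturationI[OF z(1)] by blast
qed

lemma e_in_saturation: "e \<in> saturation"
proof -
  have "S \<inter> C \<noteq> {}" using coarse C_nonempty unfolding coarsely_dense_in_def by blast
  then obtain z where "z \<in> saturation" using S_subset_saturation by blast
  then obtain y where "y \<in> saturation" "z \<star> y = e" using inverse_saturation by blast
  then show ?thesis using mul_saturation[OF \<open>z \<in> saturation\<close>] by force
qed

lemma positive_cone_saturation: "positive_cone saturation"
  unfolding positive_cone_def
proof (intro ballI allI impI)
  fix z and c :: real assume z: "z \<in> saturation" and c: "c > 0"
  have "c *\<^sub>R z = z \<star> Exp (ln c *\<^sub>R e)" using c by (simp add: Exp_scaleR_e mul.scaleR_right mul_unit_right)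
  then show "c *\<^sub>R z \<in> saturation" using coset_subset_saturation[OF z] cosetI by force
qed

lemma saturation_finite_union:
  obtains R where "finite R" "saturation = (\<Union>r\<in>R. coset r)"
proof -
  obtain R where R: "finite R" "R \<subseteq> insert e S"
    "\<And>s. s \<in> S \<Longrightarrow> \<exists>r\<in>R. \<exists>p. s = r \<star> Exp (combination p)"
    by (rule finite_representatives) (rule that)
  have "saturation \<subseteq> (\<Union>r\<in>R. coset r)"
  proof
    fix z assume "z \<in> saturation"
    then obtain s x where s: "s \<in> S" "z = s \<star> Exp x" by (rule saturationE)
    then obtain r p where r: "r \<in> R" "s = r \<star> Exp (combination p)" using R(3) by blast
    have "z \<in> coset r" unfolding s(2) r(2) by (rule coset_trans[OF cosetI cosetI])
    then show "z \<in> (\<Union>r\<in>R. coset r)" using r(1) by blast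
  qed
  moreover have "coset r \<subseteq> saturation" if "r \<in> R" for r
    using that R(2) e_in_saturation S_subset_saturation coset_subset_saturation by blast
  ultimately have "saturation = (\<Union>r\<in>R. coset r)" by blast
  then show thesis using R(1) that by blast
qed

end

section \<open>Polynomials, analytic maps and components\<close>

text \<open>On the line through \<open>a\<close> and \<open>x\<close> the function is a polynomial in one variable with infinitely
  many zeros.\<close>

lemma real_polynomial_function_zero:
  fixes q :: "'a::real_normed_vector \<Rightarrow> real"
  assumes q: "real_polynomial_function q" and U: "open U" "a \<in> U" "\<And>x. x \<in> U \<Longrightarrow> q x = 0"
  shows "q x = 0"
proof -
  define l where "l t = a + t *\<^sub>R (x - a)" for t :: real
  have "polynomial_function l"
    unfolding l_def
    by (intro polynomial_function_add polynomial_function_const polynomial_function_bounded_linear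
        bounded_linear_scaleR_left)
  then have "real_polynomial_function (q \<circ> l)" using q by (rule real_polynomial_function_compose)
  then obtain c n where c: "q \<circ> l = (\<lambda>t. \<Sum>i\<le>n. c i * t ^ i)"
    using real_polynomial_function_iff_sum by blast
  have "open (l -` U)" unfolding l_def by (intro open_vimage U(1) continuous_intros)
  moreover have "0 \<in> l -` U" using U(2) by (simp add: l_def)
  ultimately have "infinite (l -` U)"
    using not_open_singleton finite_imp_closed by (metis empty_iff finite_imp_not_open)
  moreover have "l -` U \<subseteq> {t. (\<Sum>i\<le>n. c i * t ^ i) = 0}"
  proof
    fix t assume "t \<in> l -` U"
    then have "(q \<circ> l) t = 0" using U(3) by simp
    then show "t \<in> {t. (\<Sum>i\<le>n. c i * t ^ i) = 0}" unfolding c by simp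
  qed
  ultimately have "infinite {t. (\<Sum>i\<le>n. c i * t ^ i) = 0}" using finite_subset by blast
  then have "\<forall>i\<le>n. c i = 0" using polyfun_finite_roots[where c = c and n = n] by blast
  then have "(q \<circ> l) 1 = 0" unfolding c by simp
  then show ?thesis by (simp add: l_def)
qed

text \<open>The power series at \<open>x\<close> consists of the constant \<open>f x\<close> and the linear part \<open>f\<close>.\<close>

lemma real_analytic_at_bounded_linear:
  assumes "bounded_linear f"
  shows "real_analytic_at f x"
proof -
  interpret f: bounded_linear f by fact
  obtain K where K: "K > 0" "\<And>h. norm (f h) \<le> norm h * K" using f.pos_bounded by blast
  define P where "P k h = (if k = 0 then f x else if k = 1 then f h else 0)" for k :: nat and h
  have hom: "homogeneous_polynomial k (P k)" for k
  proof -
    consider "k = 0" | "k = 1" | "k > 1" by linarith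
    then show ?thesis
    proof cases
      case 1
      then have "P k = (\<lambda>_. f x)" by (simp add: P_def fun_eq_iff)
      then show ?thesis using 1 by (simp add: homogeneous_polynomial_def)
    next
      case 2
      then have "P k = f" by (simp add: P_def fun_eq_iff)
      then show ?thesis using 2 polynomial_function_bounded_linear[OF assms]
        by (simp add: homogeneous_polynomial_def f.scaleR)
    next
      case 3
      then have "P k = (\<lambda>_. 0)" by (simp add: P_def fun_eq_iff)
      then show ?thesis by (simp add: homogeneous_polynomial_def)
    qed
  qed
  have bd: "norm (P k h) \<le> (norm (f x) + K) * (norm h / 1) ^ k" for k h
  proof -
    have "norm (f h) \<le> (norm (f x) + K) * norm h"
      using K(2)[of h] by (simp add: algebra_simps add_increasing2)
    then show ?thesis using K(1) by (simp add: P_def)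
  qed
  have sums: "(\<lambda>k. P k h) sums f (x + h)" for h
    using sums_finite[of "{0, 1}" "\<lambda>k. P k h"] by (simp add: P_def f.add)
  show ?thesis
    unfolding real_analytic_at_def using hom bd sums
    by (intro exI[of _ P] exI[of _ 1] exI[of _ "norm (f x) + K"]) simp
qed

lemma real_analytic_on_bounded_linear:
  assumes "bounded_linear F" "\<And>x. x \<in> M \<Longrightarrow> F x = f x"
  shows "real_analytic_on f M"
  unfolding real_analytic_on_def
  using assms real_analytic_at_bounded_linear
  by (intro ballI exI[of _ UNIV] exI[of _ F]) auto

lemma analytic_diffeo_bounded_linear:
  assumes "bounded_linear f" "bounded_linear g" "f ` M = N" "\<And>x. x \<in> M \<Longrightarrow> g (f x) = x"
  shows "analytic_diffeo M N f"
proof -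
  have inj: "inj_on f M" using assms(4) by (metis inj_onI)
  have "g y = inv_into M f y" if "y \<in> N" for y
    using that assms(3,4) inv_into_f_f[OF inj] by auto
  then show ?thesis
    unfolding analytic_diffeo_def bij_betw_def
    using assms inj by (intro conjI real_analytic_on_bounded_linear[of f] real_analytic_on_bounded_linear[of g]) auto
qed

lemma analytic_submanifold_open_in_subspace:
  assumes "subspace E" "open T"
  shows "analytic_submanifold (dim E) (T \<inter> E)"
  unfolding analytic_submanifold_def
proof
  fix p assume "p \<in> T \<inter> E"
  then show "\<exists>N N' (\<Phi> :: 'a \<Rightarrow> 'a) E'. open N \<and> p \<in> N \<and> open N' \<and> analytic_diffeo N N' \<Phi> \<and>
      subspace E' \<and> dim E' = dim E \<and> \<Phi> ` ((T \<inter> E) \<inter> N) = N' \<inter> E'"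
    using assms analytic_diffeo_bounded_linear[of "\<lambda>x. x" "\<lambda>x. x" T T]
    by (intro exI[of _ T] exI[of _ "\<lambda>x. x"] exI[of _ E]) auto
qed

text \<open>Each component contains one of the connected sets that it meets.\<close>

lemma finite_components_Union:
  assumes "finite \<K>" "\<And>K. K \<in> \<K> \<Longrightarrow> connected K"
  shows "finite (components (\<Union>\<K>))"
proof -
  let ?comp = "\<lambda>K. connected_component_set (\<Union>\<K>) (SOME x. x \<in> K)"
  have "components (\<Union>\<K>) \<subseteq> ?comp ` \<K>"
  proof
    fix D assume "D \<in> components (\<Union>\<K>)"
    then obtain z where z: "z \<in> \<Union>\<K>" "D = connected_component_set (\<Union>\<K>) z"
      by (auto simp: components_def)
    then obtain K where K: "K \<in> \<K>" "z \<in> K" by blast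
    then have "(SOME x. x \<in> K) \<in> K" by (metis someI)
    then have "connected_component (\<Union>\<K>) (SOME x. x \<in> K) z"
      unfolding connected_component_def using K assms(2) by blast
    then have "D = ?comp K" using z(2) connected_component_eq by fastforce
    then show "D \<in> ?comp ` \<K>" using K(1) by blast
  qed
  then show ?thesis using assms(1) finite_surj by blast
qed

section \<open>From operators to the algebra\<close>

lemma subgroup_composition_monoid:
  assumes "H \<subseteq> G" "\<And>f g. f \<in> H \<Longrightarrow> g \<in> H \<Longrightarrow> f o\<^sub>L g \<in> H" "id_blinfun \<in> H"
    and inv: "\<And>f. f \<in> H \<Longrightarrow> \<exists>g\<in>H. f o\<^sub>L g = id_blinfun \<and> g o\<^sub>L f = id_blinfun"
  shows "subgroup H (composition_monoid G)"
proof
  fix f assume f: "f \<in> H"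
  obtain g where g: "g \<in> H" "f o\<^sub>L g = id_blinfun" "g o\<^sub>L f = id_blinfun" using inv[OF f] by blast
  have "m_inv (composition_monoid G) f = g"
    unfolding m_inv_def composition_monoid_def monoid.simps partial_object.simps
  proof (rule the_equality)
    show "g \<in> G \<and> f o\<^sub>L g = id_blinfun \<and> g o\<^sub>L f = id_blinfun" using g assms(1) by blast
    fix h assume h: "h \<in> G \<and> f o\<^sub>L h = id_blinfun \<and> h o\<^sub>L f = id_blinfun"
    show "h = g"
    proof (rule blinfun_eqI)
      fix x
      have "blinfun_apply (f o\<^sub>L g) x = x" "blinfun_apply (h o\<^sub>L f) (blinfun_apply g x) = blinfun_apply g x"
        using g h by simp_all
      then show "blinfun_apply h x = blinfun_apply g x" by simp
    qed
  qed
  then show "inv\<^bsub>composition_monoid G\<^esub> f \<in> H" using g(1) by simp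
qed (use assms in \<open>auto simp: composition_monoid_def\<close>)

text \<open>The complex linear operators are the real linear ones that commute with all complex scalars.\<close>

lemma general_linear_commutant:
  fixes GLV :: "('a::euclidean_space \<Rightarrow>\<^sub>L 'a) set"
  assumes "GLV = general_linear ((*\<^sub>R) :: real \<Rightarrow> 'a \<Rightarrow> 'a) \<or>
       (\<exists>cscale :: complex \<Rightarrow> 'a \<Rightarrow> 'a. complex_structure cscale \<and> GLV = general_linear cscale)"
  obtains J :: "('a \<Rightarrow> 'a) set" where "\<And>j. j \<in> J \<Longrightarrow> linear j"
    "GLV = {g. (\<forall>j\<in>J. \<forall>x. blinfun_apply g (j x) = j (blinfun_apply g x)) \<and> bij (blinfun_apply g)}"
  using assms
proof (elim disjE exE conjE)
  assume GLV: "GLV = general_linear ((*\<^sub>R) :: real \<Rightarrow> 'a \<Rightarrow> 'a)"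
  have "linear (blinfun_apply g)" for g :: "'a \<Rightarrow>\<^sub>L 'a"
    by (simp add: blinfun.bounded_linear_right bounded_linear.linear)
  then have "GLV = {g. bij (blinfun_apply g)}"
    unfolding GLV general_linear_def linear_def by blast
  then show thesis using that[of "{}"] by simp
next
  fix cscale :: "complex \<Rightarrow> 'a \<Rightarrow> 'a"
  assume cs: "complex_structure cscale" and GLV: "GLV = general_linear cscale"
  have vs: "vector_space cscale" and cr: "\<And>r x. cscale (complex_of_real r) x = r *\<^sub>R x"
    using cs by (auto simp: complex_structure_def)
  interpret vector_space cscale by (rule vs)
  have "linear (cscale c)" for c
  proof (rule linearI)
    show "cscale c (r *\<^sub>R x) = r *\<^sub>R cscale c x" for r x
      by (simp add: mult.commute flip: cr)
  qed (simp add: scale_right_distrib)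
  moreover have "GLV = {g. (\<forall>j\<in>range cscale. \<forall>x. blinfun_apply g (j x) = j (blinfun_apply g x)) \<and> bij (blinfun_apply g)}"
    unfolding GLV general_linear_def Vector_Spaces.linear_iff using vs by (auto simp: blinfun.add_right)
  ultimately show thesis using that[of "range cscale"] by blast
qed

text \<open>A functional that vanishes on \<open>Y\<close> is bounded on \<open>C\<close> by coarse density, hence zero on \<open>C\<close>, as \<open>C\<close>
  is a cone, and hence zero, as \<open>C\<close> is open.\<close>

lemma span_coarsely_dense_in_cone:
  fixes C :: "'a::euclidean_space set"
  assumes C: "open C" "C \<noteq> {}" "positive_cone C" and d: "coarsely_dense_in (Y \<inter> C) C"
  shows "span Y = UNIV"
proof (rule ccontr)
  assume "span Y \<noteq> UNIV"
  then obtain a where a: "a \<noteq> 0" "\<And>y. y \<in> span Y \<Longrightarrow> a \<bullet> y = 0"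
    using span_not_UNIV_orthogonal by blast
  obtain D where D: "D > 0" "\<And>c. c \<in> C \<Longrightarrow> \<exists>y\<in>Y. dist y c < D"
    using d unfolding coarsely_dense_in_def by (auto simp: subset_iff) blast
  have bd: "\<bar>a \<bullet> c\<bar> \<le> norm a * D" if c: "c \<in> C" for c
  proof -
    obtain y where y: "y \<in> Y" "dist y c < D" using D(2)[OF c] by blast
    have "a \<bullet> c = a \<bullet> (c - y)" using a(2)[OF span_base[OF y(1)]] by (simp add: inner_diff_right)
    then have "\<bar>a \<bullet> c\<bar> \<le> norm a * norm (c - y)" by (metis Cauchy_Schwarz_ineq2)
    also have "\<dots> \<le> norm a * D" using y(2) by (intro mult_left_mono) (auto simp: dist_norm norm_minus_commute)
    finally show ?thesis .
  qed
  have z: "a \<bullet> c = 0" if c: "c \<in> C" for c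
  proof (rule ccontr)
    assume n: "a \<bullet> c \<noteq> 0"
    define t where "t = (norm a * D + 1) / \<bar>a \<bullet> c\<bar>"
    have "t > 0" using n D(1) by (simp add: t_def add_nonneg_pos)
    then have "t *\<^sub>R c \<in> C" using C(3) c by (simp add: positive_cone_def)
    from bd[OF this] have "t * \<bar>a \<bullet> c\<bar> \<le> norm a * D" using \<open>t > 0\<close> by (simp add: abs_mult)
    then show False using n by (simp add: t_def)
  qed
  obtain c r where c: "r > 0" "ball c r \<subseteq> C" using C(1,2) openE by blast
  have "c + (r / (2 * norm a)) *\<^sub>R a \<in> ball c r" using c(1) a(1) by (simp add: dist_norm)
  then have "a \<bullet> (c + (r / (2 * norm a)) *\<^sub>R a) = 0" using c z by blast
  moreover have "a \<bullet> c = 0" using c z centre_in_ball by blast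
  ultimately show False using a(1) c(1) by (simp add: inner_add_right)
qed

text \<open>Two operators of the span that agree at \<open>v\<close> agree on the orbit of \<open>v\<close>, because they commute with
  \<open>S\<close>, and hence everywhere. As \<open>v\<close> is cyclic, evaluation at \<open>v\<close> is thus a bijection of the algebra
  spanned by \<open>S\<close> onto the space, and the product of the algebra can be transported.\<close>

lemma cyclic_vector_algebra:
  fixes S :: "('a::euclidean_space \<Rightarrow>\<^sub>L 'a) set"
  assumes comm: "\<And>s t. s \<in> S \<Longrightarrow> t \<in> S \<Longrightarrow> s o\<^sub>L t = t o\<^sub>L s"
    and mult: "\<And>s t. s \<in> S \<Longrightarrow> t \<in> S \<Longrightarrow> s o\<^sub>L t \<in> S"
    and cyclic: "span ((\<lambda>s. blinfun_apply s v) ` S) = UNIV"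
  obtains mul where "commutative_algebra mul v" "range (commutative_algebra.L mul) = span S"
    "\<And>g. g \<in> span S \<Longrightarrow> commutative_algebra.L mul (blinfun_apply g v) = g"
proof -
  let ?A = "span S"
  have lin_ev: "linear (\<lambda>g. blinfun_apply g v)"
    by (rule bounded_linear.linear) (rule blinfun.bounded_linear_left)
  have lin_l: "linear (\<lambda>f. f o\<^sub>L g)" and lin_r: "linear (\<lambda>f. g o\<^sub>L f)" for g :: "'a \<Rightarrow>\<^sub>L 'a"
    using bounded_bilinear_blinfun_compose
    by (auto intro: bounded_linear.linear bounded_bilinear.bounded_linear_left bounded_bilinear.bounded_linear_right)
  have comm1: "f o\<^sub>L s = s o\<^sub>L f" if "f \<in> ?A" "s \<in> S" for f s
    using that(1) by (rule linear_eq_on_span[OF lin_l lin_r, rotated]) (use comm that in auto)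
  have commA: "f o\<^sub>L g = g o\<^sub>L f" if "f \<in> ?A" "g \<in> ?A" for f g
    using that(2) by (rule linear_eq_on_span[OF lin_r lin_l, rotated]) (use comm1 that in auto)
  have mult1: "f o\<^sub>L s \<in> ?A" if "f \<in> ?A" "s \<in> S" for f s
  proof -
    have "(\<lambda>f. f o\<^sub>L s) ` span S \<subseteq> span S"
      unfolding linear_span_image[OF lin_l, symmetric]
      by (rule span_mono) (use mult that in auto)
    then show ?thesis using that by blast
  qed
  have multA: "f o\<^sub>L g \<in> ?A" if "f \<in> ?A" "g \<in> ?A" for f g
  proof -
    have "(\<lambda>g. f o\<^sub>L g) ` span S = span ((\<lambda>g. f o\<^sub>L g) ` S)" by (rule linear_span_image[OF lin_r, symmetric])
    also have "\<dots> \<subseteq> ?A" by (rule span_minimal) (use mult1 that in auto)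
    finally show ?thesis using that by blast
  qed
  have onto: "(\<lambda>g. blinfun_apply g v) ` ?A = UNIV"
    using cyclic linear_span_image[OF lin_ev, of S] by simp
  have inj: "f = g" if fg: "f \<in> ?A" "g \<in> ?A" "blinfun_apply f v = blinfun_apply g v" for f g
  proof -
    have "blinfun_apply f x = blinfun_apply g x" if "x \<in> span ((\<lambda>s. blinfun_apply s v) ` S)" for x
      using that
    proof (rule linear_eq_on_span[rotated 3])
      fix x assume "x \<in> (\<lambda>s. blinfun_apply s v) ` S"
      then obtain s where s: "s \<in> S" "x = blinfun_apply s v" by blast
      have "blinfun_apply (f o\<^sub>L s) v = blinfun_apply (s o\<^sub>L f) v" "blinfun_apply (g o\<^sub>L s) v = blinfun_apply (s o\<^sub>L g) v"
        using comm1[OF fg(1) s(1)] comm1[OF fg(2) s(1)] by (simp_all only:)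
      then show "blinfun_apply f x = blinfun_apply g x" using s(2) fg(3) by simp
    qed (auto intro: bounded_linear.linear blinfun.bounded_linear_right)
    then show "f = g" using cyclic by (intro blinfun_eqI) simp
  qed
  obtain l where l: "\<And>x. l x \<in> ?A" "\<And>x. blinfun_apply (l x) v = x"
    using onto by (metis (no_types, lifting) UNIV_I image_iff)
  have lg: "l (blinfun_apply g v) = g" if "g \<in> ?A" for g
    using inj[OF l(1) that] l(2) by blast
  define mul where "mul x y = blinfun_apply (l x) y" for x y
  have mc: "mul x y = mul y x" for x y
  proof -
    have "blinfun_apply (l x o\<^sub>L l y) v = blinfun_apply (l y o\<^sub>L l x) v" using commA l(1) by metis
    then show ?thesis by (simp add: mul_def l(2))
  qed
  have "linear (mul x)" for x
    unfolding mul_def by (rule bounded_linear.linear) (rule blinfun.bounded_linear_right)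
  moreover from this have "linear (\<lambda>x. mul x y)" for y by (subst mc)
  ultimately have bil: "bilinear mul" by (simp add: bilinear_def)
  have ass: "mul (mul x y) z = mul x (mul y z)" for x y z
  proof -
    have "l (blinfun_apply (l x o\<^sub>L l y) v) = l x o\<^sub>L l y" by (intro lg multA l(1))
    then show ?thesis by (simp add: mul_def l(2))
  qed
  have unit: "mul v x = x" for x
    using mc[of v x] by (simp add: mul_def l(2))
  interpret commutative_algebra mul v
    by unfold_locales (use bil mc ass unit in auto)
  have Ll: "L x = l x" for x by (rule blinfun_eqI) (simp add: mul_def)
  have "range L = ?A"
  proof
    show "range L \<subseteq> ?A" using l(1) Ll by auto
    show "?A \<subseteq> range L" using lg Ll by (metis rangeI subsetI)
  qed
  then show thesis using that[OF commutative_algebra_axioms] lg Ll by simp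
qed

section \<open>The closure of an abelian semigroup with a coarsely dense orbit\<close>

text \<open>A point \<open>c\<close> of \<open>C\<close> is approximated by \<open>y / t\<close>, where \<open>y\<close> is within the bounded distance \<open>D\<close> of
  \<open>t c\<close>. The error is at most \<open>D / t\<close>.\<close>

lemma closure_subset_of_coarsely_dense:
  fixes C :: "'a::real_normed_vector set"
  assumes C: "positive_cone C" and U: "positive_cone U" and Y: "Y \<subseteq> U"
    and dense: "coarsely_dense_in (Y \<inter> C) C"
  shows "C \<subseteq> closure U"
proof
  fix c assume c: "c \<in> C"
  obtain D where D: "D > 0" "\<And>c. c \<in> C \<Longrightarrow> \<exists>y\<in>Y. dist y c < D"
    using dense unfolding coarsely_dense_in_def by (auto simp: subset_iff) blast
  show "c \<in> closure U"
    unfolding closure_approachable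
  proof (intro allI impI)
    fix \<epsilon> :: real assume \<epsilon>: "\<epsilon> > 0"
    define t where "t = D / \<epsilon>"
    have t: "t > 0" using D \<epsilon> by (simp add: t_def)
    have "t *\<^sub>R c \<in> C" using C c t by (simp add: positive_cone_def)
    then obtain y where y: "y \<in> Y" "dist y (t *\<^sub>R c) < D" using D(2) by blast
    have "(1 / t) *\<^sub>R y \<in> U" using U Y y(1) t by (auto simp: positive_cone_def)
    moreover have "dist ((1 / t) *\<^sub>R y) c < \<epsilon>"
    proof -
      have "(1 / t) *\<^sub>R y - c = (1 / t) *\<^sub>R (y - t *\<^sub>R c)" using t by (simp add: scaleR_right_diff_distrib)
      then have "dist ((1 / t) *\<^sub>R y) c = dist y (t *\<^sub>R c) / t" using t by (simp add: dist_norm)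
      also have "\<dots> < D / t" using y(2) t by (simp add: divide_strict_right_mono)
      finally show ?thesis using D \<epsilon> by (simp add: t_def)
    qed
    ultimately show "\<exists>y\<in>U. dist y c < \<epsilon>" by blast
  qed
qed

lemma positive_cone_closure:
  fixes U :: "'a::real_normed_vector set"
  assumes "positive_cone U"
  shows "positive_cone (closure U)"
  unfolding positive_cone_def
proof (intro ballI allI impI)
  fix x and c :: real assume "x \<in> closure U" "c > 0"
  then have "c *\<^sub>R x \<in> closure ((*\<^sub>R) c ` U)" by (simp flip: closure_scaleR)
  also have "\<dots> \<subseteq> closure U"
    using assms \<open>c > 0\<close> by (intro closure_mono) (auto simp: positive_cone_def)
  finally show "c *\<^sub>R x \<in> closure U" .
qed

lemma blinfun_compose_assoc: "(f o\<^sub>L g) o\<^sub>L h = f o\<^sub>L (g o\<^sub>L h)"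
  by (rule blinfun_eqI) simp

lemma semigroup_generated_commute:
  assumes "\<And>f g. f \<in> F \<Longrightarrow> g \<in> F \<Longrightarrow> f o\<^sub>L g = g o\<^sub>L f"
    and s: "s \<in> semigroup_generated F" and t: "t \<in> semigroup_generated F"
  shows "s o\<^sub>L t = t o\<^sub>L s"
proof -
  have 1: "f o\<^sub>L t = t o\<^sub>L f" if "f \<in> F" for f
    using t
  proof (induction rule: semigroup_generated.induct)
    case (product g h)
    then show ?case by (metis blinfun_compose_assoc)
  qed (use assms(1) that in blast)
  show ?thesis
    using s
  proof (induction rule: semigroup_generated.induct)
    case (product g h)
    then show ?case by (metis blinfun_compose_assoc)
  qed (use 1 in blast)
qed

theorem theorem3p1:
  fixes GLV F S Sbar Z :: "('a::euclidean_space \<Rightarrow>\<^sub>L 'a) set"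
    and C orbit :: "'a set"
    and v0 :: 'a
  assumes V_real_or_complex:
      "GLV = general_linear ((*\<^sub>R) :: real \<Rightarrow> 'a \<Rightarrow> 'a) \<or>
       (\<exists>cscale :: complex \<Rightarrow> 'a \<Rightarrow> 'a. complex_structure cscale \<and> GLV = general_linear cscale)"
    and generators: "finite F" "F \<subseteq> GLV"
    and commute: "\<And>f g. f \<in> F \<Longrightarrow> g \<in> F \<Longrightarrow> f o\<^sub>L g = g o\<^sub>L f"
    and S: "S = semigroup_generated F"
    and orbit: "orbit = (\<lambda>s. blinfun_apply s v0) ` S"
    and C: "open C" "C \<noteq> {}" "positive_cone C"
    and dense: "coarsely_dense_in (orbit \<inter> C) C"
    and Sbar: "Sbar = (top_of_set GLV) closure_of S"
    and Z: "Z = zariski_closed GLV hull S"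
  shows
    "(subgroup Z (composition_monoid GLV) \<and>
      subgroup Sbar (composition_monoid Z) \<and>
      openin (top_of_set Z) Sbar \<and>
      finite (components Sbar)) \<and>
     (analytic_submanifold DIM('a) Sbar \<and>
      (\<exists>U. open U \<and> positive_cone U \<and> analytic_diffeo Sbar U (\<lambda>g. blinfun_apply g v0))) \<and>
     (positive_cone (closure orbit) \<and> C \<subseteq> closure orbit)"
proof -
  obtain J :: "('a \<Rightarrow> 'a) set" where J: "\<And>j. j \<in> J \<Longrightarrow> linear j"
    and GLV: "GLV = {g. (\<forall>j\<in>J. \<forall>x. blinfun_apply g (j x) = j (blinfun_apply g x)) \<and> bij (blinfun_apply g)}"
    by (rule general_linear_commutant[OF V_real_or_complex]) (rule that)
  have compose_apply: "blinfun_apply (f o\<^sub>L g) = blinfun_apply f \<circ> blinfun_apply g" for f g :: "'a \<Rightarrow>\<^sub>L 'a"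
    by (simp add: fun_eq_iff)
  have S_GLV: "S \<subseteq> GLV"
  proof
    fix s assume "s \<in> S"
    then show "s \<in> GLV"
      unfolding S
    proof (induction rule: semigroup_generated.induct)
      case (product f g)
      then show ?case unfolding GLV by (auto simp: compose_apply intro: bij_comp)
    qed (use generators(2) in blast)
  qed
  have comm_S: "s o\<^sub>L t = t o\<^sub>L s" if "s \<in> S" "t \<in> S" for s t
    using commute that unfolding S by (rule semigroup_generated_commute)
  have mult_S: "s o\<^sub>L t \<in> S" if "s \<in> S" "t \<in> S" for s t
    using that unfolding S by (rule semigroup_generated.product)
  have "span orbit = UNIV" by (rule span_coarsely_dense_in_cone[OF C dense])
  then obtain mul where alg: "commutative_algebra mul v0"
    and range_L: "range (commutative_algebra.L mul) = span S"
    and L_span: "\<And>g. g \<in> span S \<Longrightarrow> commutative_algebra.L mul (blinfun_apply g v0) = g"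
    using cyclic_vector_algebra[OF comm_S mult_S, where v = v0] unfolding orbit by metis
  interpret A: commutative_algebra mul v0 by (rule alg)
  have L_S: "A.L (blinfun_apply s v0) = s" if "s \<in> S" for s
    using that by (intro L_span span_base)
  have unit_GLV: "A.unit (blinfun_apply g v0)" if "g \<in> span S" "g \<in> GLV" for g
    using that(2) L_span[OF that(1)] A.bij_L_iff_unit[of "blinfun_apply g v0"] by (simp add: GLV)
  have L_GLV: "A.L x \<in> GLV" if "A.unit x" for x
  proof -
    have "span S \<subseteq> {g. \<forall>j\<in>J. \<forall>x. blinfun_apply g (j x) = j (blinfun_apply g x)}"
    proof (rule span_minimal)
      show "S \<subseteq> {g. \<forall>j\<in>J. \<forall>x. blinfun_apply g (j x) = j (blinfun_apply g x)}"
        using S_GLV unfolding GLV by blast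
      show "subspace {g. \<forall>j\<in>J. \<forall>x. blinfun_apply g (j x) = j (blinfun_apply g x)}"
        by (rule subspaceI) (auto simp: blinfun.bilinear_simps linear_0[OF J] linear_add[OF J] linear_scale[OF J])
    qed
    moreover have "A.L x \<in> span S" unfolding range_L[symmetric] by (rule rangeI)
    ultimately show ?thesis using that A.bij_L_iff_unit unfolding GLV by blast
  qed
  define F0 where "F0 = (\<lambda>f. blinfun_apply f v0) ` F"
  have orbit_eq: "orbit = A.semigroup F0"
  proof
    have "blinfun_apply s v0 \<in> A.semigroup F0" if "s \<in> S" for s
      using that unfolding S
    proof (induction rule: semigroup_generated.induct)
      case (generator f)
      then show ?case unfolding F0_def by (intro A.semigroup.generator) blast
    next
      case (product f g)
      have "A.L (blinfun_apply f v0) = f" using product.hyps(1) L_S unfolding S by blast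
      then have "blinfun_apply (f o\<^sub>L g) v0 = mul (blinfun_apply f v0) (blinfun_apply g v0)"
        by (simp flip: A.L_apply)
      then show ?case using A.semigroup.product[OF product.IH] by (simp only:)
    qed
    then show "orbit \<subseteq> A.semigroup F0" unfolding orbit by blast
    show "A.semigroup F0 \<subseteq> orbit"
    proof
      fix z assume "z \<in> A.semigroup F0"
      then show "z \<in> orbit"
      proof (induction rule: A.semigroup.induct)
        case (generator z)
        then obtain f where f: "f \<in> F" "z = blinfun_apply f v0" unfolding F0_def by blast
        have "f \<in> S" unfolding S using f(1) by (rule semigroup_generated.generator)
        then show ?case unfolding orbit f(2) by (rule imageI)
      next
        case (product x y)
        then obtain s t where st: "s \<in> S" "x = blinfun_apply s v0" "t \<in> S" "y = blinfun_apply t v0"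
          unfolding orbit by blast
        have "mul x y = blinfun_apply (A.L x) y" by simp
        also have "A.L x = s" unfolding st(2) by (rule L_S[OF st(1)])
        also have "blinfun_apply s y = blinfun_apply (s o\<^sub>L t) v0" unfolding st(4) by simp
        finally have "mul x y = blinfun_apply (s o\<^sub>L t) v0" .
        then show ?case unfolding orbit using mult_S[OF st(1,3)] by blast
      qed
    qed
  qed
  have unit_F0: "A.unit f" if f: "f \<in> F0" for f
  proof -
    obtain g where g: "g \<in> F" "f = blinfun_apply g v0" using f unfolding F0_def by blast
    have "g \<in> S" unfolding S using g(1) by (rule semigroup_generated.generator)
    then show ?thesis unfolding g(2) using S_GLV by (intro unit_GLV span_base) auto
  qed
  have "\<exists>x. A.Exp x = mul f f" if "f \<in> F0" for f
    using unit_F0[OF that] by (rule A.square_of_unit) blast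
  then obtain X where X: "\<And>f. f \<in> F0 \<Longrightarrow> A.Exp (X f) = mul f f" by metis
  interpret D: coarsely_dense_semigroup mul v0 F0 X C
    by unfold_locales (use generators(1) X unit_F0 C dense orbit_eq in \<open>auto simp: F0_def\<close>)
  have closed_span: "closed {g. A.L (blinfun_apply g v0) = g}"
    by (intro closed_Collect_eq continuous_on_id bounded_linear.continuous_on[OF A.bounded_linear_L]
        bounded_linear.continuous_on[OF blinfun.bounded_linear_left])
  have Sbar_eq: "Sbar = A.L ` D.saturation"
  proof -
    have "Sbar = GLV \<inter> closure S"
      unfolding Sbar closure_of_subtopology using S_GLV by (simp add: Int_absorb1 Int_absorb2 inf.absorb2)
    also have "\<dots> = A.L ` D.saturation"
    proof
      show "GLV \<inter> closure S \<subseteq> A.L ` D.saturation"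
      proof
        fix g assume g: "g \<in> GLV \<inter> closure S"
        have "closure S \<subseteq> {g. A.L (blinfun_apply g v0) = g}"
          using closed_span L_S by (intro closure_minimal) auto
        then have Lg: "A.L (blinfun_apply g v0) = g" using g by blast
        then have "g \<in> span S" unfolding range_L[symmetric] by (metis rangeI)
        then have "A.unit (blinfun_apply g v0)" using g unit_GLV by blast
        moreover have "(\<lambda>g. blinfun_apply g v0) ` closure S \<subseteq> closure orbit"
          unfolding orbit
          by (intro image_closure_subset closed_closure closure_subset continuous_on_id
              bounded_linear.continuous_on[OF blinfun.bounded_linear_left])
        then have "blinfun_apply g v0 \<in> closure orbit" using g by blast
        ultimately have "blinfun_apply g v0 \<in> D.saturation" using D.unit_in_closure orbit_eq by blast
        then show "g \<in> A.L ` D.saturation" using Lg by (metis image_eqI)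
      qed
      show "A.L ` D.saturation \<subseteq> GLV \<inter> closure S"
      proof (intro subsetI IntI)
        fix g assume "g \<in> A.L ` D.saturation"
        then obtain z where z: "z \<in> D.saturation" "g = A.L z" by blast
        show "g \<in> GLV" using z L_GLV D.unit_saturation by blast
        have "A.L ` closure orbit \<subseteq> closure S"
          using L_S by (intro image_closure_subset bounded_linear.continuous_on[OF A.bounded_linear_L] continuous_on_id)
             (auto simp: orbit closure_subset[THEN subsetD])
        moreover have "z \<in> closure orbit" using z(1) D.saturation_subset_closure orbit_eq by blast
        ultimately show "g \<in> closure S" using z(2) by blast
      qed
    qed
    finally show ?thesis .
  qed
  have Z_eq: "Z = A.L ` {x. A.unit x}"
  proof
    \<comment> \<open>The linear equations \<open>L (g v0) = g\<close> define the algebra spanned by \<open>S\<close>. Their coordinates are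
      tested by inner products with all vectors.\<close>
    define p where "p yb g = (blinfun_apply (A.L (blinfun_apply g v0)) (fst yb) - blinfun_apply g (fst yb)) \<bullet> snd yb"
      for yb :: "'a \<times> 'a" and g
    have "bounded_linear (p yb)" for yb
    proof -
      have "bounded_linear (\<lambda>g. blinfun_apply (A.L (blinfun_apply g v0)) (fst yb))"
        by (intro bounded_linear_compose[OF blinfun.bounded_linear_left]
            bounded_linear_compose[OF A.bounded_linear_L] blinfun.bounded_linear_left)
      then show ?thesis
        unfolding p_def
        by (intro bounded_linear_inner_left_comp bounded_linear_sub blinfun.bounded_linear_left)
    qed
    then have "\<forall>q\<in>range p. real_polynomial_function q" by (auto intro: real_polynomial_function.intros(1))
    moreover have "{g \<in> GLV. A.L (blinfun_apply g v0) = g} = {g \<in> GLV. \<forall>q\<in>range p. q g = 0}"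
    proof -
      have "A.L (blinfun_apply g v0) = g" if "\<And>yb. p yb g = 0" for g
      proof (rule blinfun_eqI)
        fix y
        show "blinfun_apply (A.L (blinfun_apply g v0)) y = blinfun_apply g y"
          using that[of "(y, blinfun_apply (A.L (blinfun_apply g v0)) y - blinfun_apply g y)"]
          by (simp add: p_def)
      qed
      moreover have "p yb g = 0" if "A.L (blinfun_apply g v0) = g" for yb g
        unfolding p_def that by simp
      ultimately show ?thesis by auto
    qed
    ultimately have "zariski_closed GLV {g \<in> GLV. A.L (blinfun_apply g v0) = g}"
      unfolding zariski_closed_def by blast
    then have "Z \<subseteq> {g \<in> GLV. A.L (blinfun_apply g v0) = g}"
      unfolding Z using S_GLV L_S by (intro hull_minimal) auto
    also have "\<dots> \<subseteq> A.L ` {x. A.unit x}"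
    proof
      fix g assume "g \<in> {g \<in> GLV. A.L (blinfun_apply g v0) = g}"
      then have "g \<in> GLV" "A.L (blinfun_apply g v0) = g" by auto
      then show "g \<in> A.L ` {x. A.unit x}"
        using unit_GLV range_L by (metis image_eqI mem_Collect_eq rangeI)
    qed
    finally show "Z \<subseteq> A.L ` {x. A.unit x}" .
    show "A.L ` {x. A.unit x} \<subseteq> Z"
      unfolding Z hull_def
    proof (intro subsetI InterI)
      fix g T assume g: "g \<in> A.L ` {x. A.unit x}" and "T \<in> {T. zariski_closed GLV T \<and> S \<subseteq> T}"
      then obtain \<P> where \<P>: "\<forall>q\<in>\<P>. real_polynomial_function q" "T = {g \<in> GLV. \<forall>q\<in>\<P>. q g = 0}" "S \<subseteq> T"
        unfolding zariski_closed_def by blast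
      obtain x where x: "A.unit x" "g = A.L x" using g by blast
      have "q g = 0" if q: "q \<in> \<P>" for q
      proof -
        have pq: "real_polynomial_function (q \<circ> A.L)"
          using \<P>(1) q polynomial_function_bounded_linear[OF A.bounded_linear_L]
          by (intro real_polynomial_function_compose) auto
        have "orbit \<subseteq> {z. (q \<circ> A.L) z = 0}" using \<P>(2,3) q L_S unfolding orbit by auto
        moreover have "closed {z. (q \<circ> A.L) z = 0}"
          using pq unfolding real_polynomial_function_eq
          by (intro closed_Collect_eq continuous_on_const continuous_on_polymonial_function)
        \<comment> \<open>The closure of the orbit contains the nonempty open set \<open>D.saturation\<close>.\<close>
        ultimately have "closure orbit \<subseteq> {z. (q \<circ> A.L) z = 0}" by (rule closure_minimal)
        then have "(q \<circ> A.L) z = 0" if "z \<in> D.saturation" for z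
          using that D.saturation_subset_closure orbit_eq by blast
        then have "(q \<circ> A.L) x = 0"
          by (rule real_polynomial_function_zero[OF pq D.open_saturation D.e_in_saturation])
        then show ?thesis using x(2) by simp
      qed
      then show "g \<in> T" using \<P>(2) L_GLV x by simp
    qed
  qed
  have "subgroup Z (composition_monoid GLV)"
  proof (rule subgroup_composition_monoid)
    show "Z \<subseteq> GLV" unfolding Z_eq using L_GLV by blast
    show "f o\<^sub>L g \<in> Z" if "f \<in> Z" "g \<in> Z" for f g
      using that A.unit_mul unfolding Z_eq by (auto simp flip: A.L_mul)
    show "id_blinfun \<in> Z" unfolding Z_eq using A.unit_e A.L_e by (metis image_eqI mem_Collect_eq)
    fix f assume "f \<in> Z"
    then obtain x where x: "A.unit x" "f = A.L x" unfolding Z_eq by blast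
    then obtain y where y: "mul x y = v0" "mul y x = v0" by (metis A.unit_def A.mul_commute)
    then have "A.L y \<in> Z" unfolding Z_eq A.unit_def by blast
    then show "\<exists>g\<in>Z. f o\<^sub>L g = id_blinfun \<and> g o\<^sub>L f = id_blinfun"
      using y x(2) A.L_mul[of x y] A.L_mul[of y x] A.L_e by (intro bexI[of _ "A.L y"]) auto
  qed
  moreover have "subgroup Sbar (composition_monoid Z)"
  proof (rule subgroup_composition_monoid)
    show "Sbar \<subseteq> Z" unfolding Z_eq Sbar_eq using D.unit_saturation by blast
    show "f o\<^sub>L g \<in> Sbar" if "f \<in> Sbar" "g \<in> Sbar" for f g
      using that D.mul_saturation unfolding Sbar_eq by (auto simp flip: A.L_mul)
    show "id_blinfun \<in> Sbar" unfolding Sbar_eq using D.e_in_saturation A.L_e by (metis image_eqI)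
    fix f assume "f \<in> Sbar"
    then obtain x where x: "x \<in> D.saturation" "f = A.L x" unfolding Sbar_eq by blast
    then obtain y where y: "y \<in> D.saturation" "mul x y = v0" "mul y x = v0" by (metis D.inverse_saturation A.mul_commute)
    then show "\<exists>g\<in>Sbar. f o\<^sub>L g = id_blinfun \<and> g o\<^sub>L f = id_blinfun"
      using x(2) A.L_mul[of x y] A.L_mul[of y x] A.L_e unfolding Sbar_eq by (intro bexI[of _ "A.L y"]) auto
  qed
  moreover have "openin (top_of_set Z) Sbar"
  proof -
    have "open ((\<lambda>g. blinfun_apply g v0) -` D.saturation)"
      by (intro open_vimage D.open_saturation bounded_linear.continuous_on[OF blinfun.bounded_linear_left] continuous_on_id)
    moreover have "Sbar = Z \<inter> (\<lambda>g. blinfun_apply g v0) -` D.saturation"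
      unfolding Sbar_eq Z_eq using D.unit_saturation A.L_apply_e by auto
    ultimately show ?thesis by (simp add: openin_open) blast
  qed
  moreover have "finite (components Sbar)"
  proof -
    obtain R where R: "finite R" "D.saturation = (\<Union>r\<in>R. A.coset r)"
      by (rule D.saturation_finite_union) (rule that)
    have "Sbar = \<Union> ((\<lambda>r. A.L ` A.coset r) ` R)" unfolding Sbar_eq R(2) by blast
    moreover have "connected (A.L ` A.coset r)" for r
      by (intro connected_continuous_image A.connected_coset bounded_linear.continuous_on[OF A.bounded_linear_L] continuous_on_id)
    ultimately show ?thesis using finite_components_Union[of "(\<lambda>r. A.L ` A.coset r) ` R"] R(1) by auto
  qed
  moreover have "analytic_submanifold DIM('a) Sbar"
  proof -
    have "Sbar = (\<lambda>g. blinfun_apply g v0) -` D.saturation \<inter> range A.L"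
      unfolding Sbar_eq using A.L_apply_e by auto
    moreover have "open ((\<lambda>g. blinfun_apply g v0) -` D.saturation)"
      by (intro open_vimage D.open_saturation bounded_linear.continuous_on[OF blinfun.bounded_linear_left] continuous_on_id)
    ultimately show ?thesis
      using analytic_submanifold_open_in_subspace[OF A.subspace_range_L] A.dim_range_L by metis
  qed
  moreover have "analytic_diffeo Sbar D.saturation (\<lambda>g. blinfun_apply g v0)"
    by (rule analytic_diffeo_bounded_linear[OF blinfun.bounded_linear_left A.bounded_linear_L])
       (auto simp: Sbar_eq image_image A.L_apply_e simp del: A.L_apply)
  moreover have "closure orbit = closure D.saturation"
    using D.S_subset_saturation D.saturation_subset_closure orbit_eq closure_minimal[OF D.saturation_subset_closure closed_closure]
    by (simp add: closure_mono subset_antisym)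
  moreover have "C \<subseteq> closure D.saturation"
    using C(3) D.positive_cone_saturation D.S_subset_saturation[folded orbit_eq] dense by (rule closure_subset_of_coarsely_dense)
  moreover have "positive_cone (closure D.saturation)"
    using D.positive_cone_saturation by (rule positive_cone_closure)
  ultimately show ?thesis using D.open_saturation D.positive_cone_saturation by auto
qed

end
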